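(* Let $A:\mathbb{R}^p\to\mathbb{R}^{n\times n}$ and $C:\mathbb{R}^p\to\mathbb{R}^{m\times n}$ be polynomial maps such that the pair $(C(0),A(0))$ is observable, and let $d=n\deg C+\frac{n(n-1)}{2}\deg A$. Let $N\ge\binom{p+d}{p}$ and let $\{v_k\}_{0\le k<N}\subset\mathbb{R}^p$ be in $(d,p)$-general position with $v_0=(1,0,\dots,0)$. For $\Delta>0$ and $0\le k<N$ set $$v_\Delta(s)=v_0+\Delta(v_k-v_0),\qquad s\in\Big[\frac{k\Delta}{N},\frac{(k+1)\Delta}{N}\Big).$$ Then, for $T>0$, $(v_\Delta)_{\Delta\in(0,T]}$ is a control template family for the system $\dot x=A(u)x+b(u)$, $y=C(u)x$ (where $b:\mathbb{R}^p\to\mathbb{R}^n$ is continuous).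
   Context: Notation: $|\cdot|$ is the Euclidean norm, $'$ denotes transposition, $\mathrm{O}(p)$ is the group of $p\times p$ real orthogonal matrices; $\deg A$, $\deg C$ are the degrees of the polynomial maps $A$, $C$ (maximal total degree of the entries). A function $\kappa:\mathbb{R}_+\to\mathbb{R}_+$ is of class $\mathcal{K}$ if it is continuous, increasing and $\kappa(0)=0$. The pair $(C(0),A(0))$ is observable if the $mn\times n$ matrix obtained by stacking $C(0),C(0)A(0),\dots,C(0)A(0)^{n-1}$ has rank $n$. General position: a subset $E\subset\mathbb{R}^p$ is in $(d,p)$-general position if for each nonzero polynomial $h\in\mathbb{R}[X_1,\dots,X_p]$ of degree $d$ or less there exists $v\in E$ such that $h(v)\ne0$. Observability Gramian: for an essentially bounded input $u$ on an interval containing $[s,t]$, let $\Phi_u(t,s)$ solve $\frac{\partial\Phi_u}{\partial t}(t,s)=A(u(t))\Phi_u(t,s)$, $\Phi_u(s,s)=\mathrm{Id}$, and set $\mathcal{G}_u(t,s)=\int_s^t\Phi_u(\tau,t)'C(u(\tau))'C(u(\tau))\Phi_u(\tau,t)\,\mathrm{d}\tau$. Control template: an input $v\in L^\infty([0,\Delta],\mathbb{R}^p)$ is a control template if for all $\bar\lambda\ge0$ there exists $g(\Delta)>0$ such that $\mathcal{G}_{\mu\mathsf{R}v}(\Delta,0)\ge g(\Delta)\mathrm{Id}$ for all $(\mu,\mathsf{R})\in[0,\bar\lambda]\times\mathrm{O}(p)$. Control template family: let $T>0$. A family $(v_\Delta)_{\Delta\in(0,T]}$ is a control template family if there is a class $\mathcal{K}$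 function $\kappa$ such that for every $\Delta\in(0,T]$: $v_\Delta\in L^\infty([0,\Delta],\mathbb{R}^p)$; $v_\Delta$ is continuous at $0$ and $v_\Delta(0)=(1,0,\dots,0)$; $|v_\Delta(s)-v_\Delta(0)|\le\kappa(\Delta)$ for all $s\in[0,\Delta]$; and $v_\Delta$ is a control template. (The value of the piecewise constant $v_\Delta$ at the single endpoint $s=\Delta$ is immaterial; one may take it equal to the value on the last subinterval.) *)

theory Defs
  imports "HOL-Analysis.Analysis" "HOL-Library.Poly_Mapping"
begin

text \<open>Polynomials in the indeterminates \<open>X\<^sub>i\<close>, \<open>i :: 'p\<close>, as finitely supported maps
  from exponent vectors to real coefficients.\<close>

type_synonym 'p rpoly = "('p \<Rightarrow>\<^sub>0 nat) \<Rightarrow>\<^sub>0 real"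

definition rpoly_eval :: "('p::finite) rpoly \<Rightarrow> real ^ 'p \<Rightarrow> real" where
  "rpoly_eval P x =
     (\<Sum>e\<in>Poly_Mapping.keys P.
        Poly_Mapping.lookup P e * (\<Prod>i\<in>UNIV. (x $ i) ^ Poly_Mapping.lookup e i))"

text \<open>Total degree, with the convention that the zero polynomial has degree \<open>0\<close>.\<close>

definition rpoly_degree :: "('p::finite) rpoly \<Rightarrow> nat" where
  "rpoly_degree P =
     Max (insert 0 ((\<lambda>e. \<Sum>i\<in>UNIV. Poly_Mapping.lookup e i) ` Poly_Mapping.keys P))"

text \<open>A polynomial map into matrices is given by its matrix of entries. Over the reals a
  polynomial is determined by its values, so the degree depends on the map only.\<close>

definition polymap :: "('p::finite) rpoly ^ 'n ^ 'm \<Rightarrow> real ^ 'p \<Rightarrow> real ^ 'n ^ 'm" where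
  "polymap P u = (\<chi> i j. rpoly_eval (P $ i $ j) u)"

definition polymap_degree :: "('p::finite) rpoly ^ 'n ^ 'm \<Rightarrow> nat" where
  "polymap_degree P = Max {rpoly_degree (P $ i $ j) | i j. True}"

definition general_position :: "nat \<Rightarrow> (real ^ ('p::finite)) set \<Rightarrow> bool" where
  "general_position d E \<longleftrightarrow>
     (\<forall>h. h \<noteq> 0 \<and> rpoly_degree h \<le> d \<longrightarrow> (\<exists>v\<in>E. rpoly_eval h v \<noteq> 0))"

definition matrix_power :: "real ^ 'n ^ 'n \<Rightarrow> nat \<Rightarrow> real ^ 'n ^ 'n" where
  "matrix_power M k = (((**) M) ^^ k) (mat 1)"

text \<open>The rows of the stacked matrix are indexed by pairs of a block and a row in that block.
  On the finite set \<open>UNIV :: 'n set\<close>, \<^const>\<open>to_nat_on\<close> is a bijection onto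
  \<open>{..<CARD('n)}\<close>, so that the blocks are \<open>C, C A, \<dots>, C A\<^bsup>n-1\<^esup>\<close>.\<close>

definition observability_matrix ::
  "real ^ 'n ^ 'm \<Rightarrow> real ^ 'n ^ 'n \<Rightarrow> real ^ 'n ^ ('n \<times> 'm)" where
  "observability_matrix C A =
     (\<chi> r. row (snd r) (C ** matrix_power A (to_nat_on (UNIV :: 'n set) (fst r))))"

definition observable :: "real ^ 'n ^ 'm \<Rightarrow> real ^ 'n ^ 'n \<Rightarrow> bool" where
  "observable C A \<longleftrightarrow> rank (observability_matrix C A) = CARD('n)"

definition L_infinity :: "real \<Rightarrow> real \<Rightarrow> (real \<Rightarrow> real ^ 'p) \<Rightarrow> bool" where
  "L_infinity a b u \<longleftrightarrow>
     u \<in> borel_measurable (lebesgue_on {a..b}) \<and>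
     (\<exists>B. AE t in lebesgue_on {a..b}. norm (u t) \<le> B)"

text \<open>Inputs are only measurable, so the linear matrix differential equation
  \<open>X' = A(u) X\<close>, \<open>X(s) = Id\<close> is understood in the sense of Caratheodory: \<open>X\<close> is an
  indefinite Lebesgue integral of the right-hand side (equivalently, \<open>X\<close> is absolutely
  continuous and satisfies the equation almost everywhere).\<close>

definition fundamental_solution ::
  "(real ^ 'p \<Rightarrow> real ^ 'n ^ 'n) \<Rightarrow> (real \<Rightarrow> real ^ 'p) \<Rightarrow> real \<Rightarrow> real \<Rightarrow> real \<Rightarrow>
     (real \<Rightarrow> real ^ 'n ^ 'n) \<Rightarrow> bool" where
  "fundamental_solution A u a b s X \<longleftrightarrow>
     X s = mat 1 \<and>
     (\<lambda>\<tau>. A (u \<tau>) ** X \<tau>) absolutely_integrable_on {a..b} \<and>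
     (\<forall>c d. a \<le> c \<and> c \<le> d \<and> d \<le> b \<longrightarrow>
        X d - X c = integral {c..d} (\<lambda>\<tau>. A (u \<tau>) ** X \<tau>))"

text \<open>\<open>\<Phi>\<^sub>u(t,s)\<close>, for \<open>s \<le> t\<close> as well as for \<open>t \<le> s\<close> (the Gramian uses the latter).\<close>

definition transition_matrix ::
  "(real ^ 'p \<Rightarrow> real ^ 'n ^ 'n) \<Rightarrow> (real \<Rightarrow> real ^ 'p) \<Rightarrow> real \<Rightarrow> real \<Rightarrow> real ^ 'n ^ 'n" where
  "transition_matrix A u t s =
     (THE M. \<exists>X. fundamental_solution A u (min s t) (max s t) s X \<and> X t = M)"

definition gramian ::
  "(real ^ 'p \<Rightarrow> real ^ 'n ^ 'n) \<Rightarrow> (real ^ 'p \<Rightarrow> real ^ 'n ^ 'm) \<Rightarrow> (real \<Rightarrow> real ^ 'p) \<Rightarrow>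
     real \<Rightarrow> real \<Rightarrow> real ^ 'n ^ 'n" where
  "gramian A C u t s =
     integral {s..t} (\<lambda>\<tau>.
       transpose (transition_matrix A u \<tau> t) ** transpose (C (u \<tau>)) **
       C (u \<tau>) ** transition_matrix A u \<tau> t)"

definition positive_semidefinite :: "real ^ 'n ^ 'n \<Rightarrow> bool" where
  "positive_semidefinite M \<longleftrightarrow> transpose M = M \<and> (\<forall>x. 0 \<le> x \<bullet> (M *v x))"

definition control_template ::
  "(real ^ 'p \<Rightarrow> real ^ 'n ^ 'n) \<Rightarrow> (real ^ 'p \<Rightarrow> real ^ 'n ^ 'm) \<Rightarrow> real \<Rightarrow>
     (real \<Rightarrow> real ^ 'p) \<Rightarrow> bool" where
  "control_template A C \<Delta> v \<longleftrightarrow>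
     L_infinity 0 \<Delta> v \<and>
     (\<forall>L\<ge>0. \<exists>g>0. \<forall>\<mu> R. 0 \<le> \<mu> \<and> \<mu> \<le> L \<and> orthogonal_matrix R \<longrightarrow>
        positive_semidefinite
          (gramian A C (\<lambda>s. \<mu> *\<^sub>R (R *v v s)) \<Delta> 0 - g *\<^sub>R mat 1))"

definition class_K :: "(real \<Rightarrow> real) \<Rightarrow> bool" where
  "class_K \<kappa> \<longleftrightarrow>
     \<kappa> ` {0..} \<subseteq> {0..} \<and> continuous_on {0..} \<kappa> \<and> strict_mono_on {0..} \<kappa> \<and> \<kappa> 0 = 0"

text \<open>The index \<open>\<iota>\<close> names the first coordinate, so that \<open>axis \<iota> 1\<close> is \<open>(1,0,\<dots>,0)\<close>.\<close>

definition control_template_family ::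
  "'p \<Rightarrow> (real ^ ('p::finite) \<Rightarrow> real ^ 'n ^ 'n) \<Rightarrow> (real ^ 'p \<Rightarrow> real ^ 'n ^ 'm) \<Rightarrow> real \<Rightarrow>
     (real \<Rightarrow> real \<Rightarrow> real ^ 'p) \<Rightarrow> bool" where
  "control_template_family \<iota> A C T v \<longleftrightarrow>
     (\<exists>\<kappa>. class_K \<kappa> \<and>
        (\<forall>\<Delta>. 0 < \<Delta> \<and> \<Delta> \<le> T \<longrightarrow>
           L_infinity 0 \<Delta> (v \<Delta>) \<and>
           continuous (at 0 within {0..\<Delta>}) (v \<Delta>) \<and>
           v \<Delta> 0 = axis \<iota> 1 \<and>
           (\<forall>s\<in>{0..\<Delta>}. norm (v \<Delta> s - v \<Delta> 0) \<le> \<kappa> \<Delta>) \<and>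
           control_template A C \<Delta> (v \<Delta>)))"

end

theory Submission
  imports Defs
begin

text \<open>Choosing rows of the observability matrix at \<open>u = 0\<close> greedily, block by block, gives a
  nonvanishing \<open>n \<times> n\<close> minor whose \<open>j\<close>-th row (\<open>j < n\<close>) comes from a block of index at most \<open>j\<close>.
  As a function of \<open>u\<close> this minor is a polynomial of degree at most \<open>d\<close>. Composed with
  \<open>u \<mapsto> \<mu> R (v\<^sub>0 + \<Delta> (u - v\<^sub>0))\<close> it is still nonzero, because this map takes the value \<open>0\<close>, so
  general position yields a subinterval on which the rotated and scaled constant input makes the
  system observable; hence the Gramian is positive definite for every \<open>(\<mu>, R)\<close>. On piecewise
  constant inputs the transition matrix is a product of matrix exponentials, so the output energy is
  continuous in \<open>(\<mu>, R, x)\<close>, and compactness of \<open>[0, \<lambda>] \<times> O(p) \<times> S\<^bsup>n-1\<^esup>\<close> makes the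
  lower bound uniform.\<close>

subsection \<open>Matrix exponential\<close>

lemma bounded_bilinear_matrix_matrix_mult:
  "bounded_bilinear ((**) :: real^'k^'m \<Rightarrow> real^'n^'k \<Rightarrow> real^'n^'m)"
  unfolding bilinear_conv_bounded_bilinear[symmetric] bilinear_def
  by (auto intro!: linearI simp: matrix_matrix_mult_def vec_eq_iff sum.distrib algebra_simps sum_distrib_left)

lemmas scaleR_matrix_mult_left = bounded_bilinear.scaleR_left[OF bounded_bilinear_matrix_matrix_mult]
lemmas scaleR_matrix_mult_right = bounded_bilinear.scaleR_right[OF bounded_bilinear_matrix_matrix_mult]

lemma bounded_bilinear_matrix_vector_mult:
  "bounded_bilinear ((*v) :: real^'n^'m \<Rightarrow> real^'n \<Rightarrow> real^'m)"
  unfolding bilinear_conv_bounded_bilinear[symmetric] bilinear_def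
  by (auto intro!: linearI simp: matrix_vector_mult_add_rdistrib matrix_vector_right_distrib
      scaleR_matrix_vector_assoc matrix_vector_mult_scaleR)

lemmas continuous_on_matrix_mult [continuous_intros] =
  bounded_bilinear.continuous_on[OF bounded_bilinear_matrix_matrix_mult]
lemmas continuous_on_matrix_vector_mult [continuous_intros] =
  bounded_bilinear.continuous_on[OF bounded_bilinear_matrix_vector_mult]

lemma bounded_linear_transpose: "bounded_linear (transpose :: real^'n^'m \<Rightarrow> real^'m^'n)"
  unfolding linear_conv_bounded_linear[symmetric]
  by (auto intro!: linearI simp: transpose_def vec_eq_iff)

lemmas continuous_on_transpose [continuous_intros] =
  bounded_linear.continuous_on[OF bounded_linear_transpose]

lemma matrix_power_0 [simp]: "matrix_power M 0 = mat 1"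
  by (simp add: matrix_power_def)

lemma matrix_power_Suc: "matrix_power M (Suc k) = M ** matrix_power M k"
  by (simp add: matrix_power_def)

lemma matrix_power_Suc2: "matrix_power M (Suc k) = matrix_power M k ** M"
  by (induction k) (simp_all add: matrix_power_Suc matrix_mul_assoc)

lemma matrix_power_scaleR: "matrix_power (c *\<^sub>R M) k = c ^ k *\<^sub>R matrix_power M k"
  by (induction k) (simp_all add: matrix_power_Suc scaleR_matrix_mult_left scaleR_matrix_mult_right)

text \<open>\<open>K\<close> is the bound of matrix multiplication as a bounded bilinear map.
  Geometric growth of the powers is enough to dominate the exponential series, so
  submultiplicativity of the norm is not at issue.\<close>

lemma norm_matrix_power_le:
  obtains K where "K > 0" "\<And>k (M :: real^'n^'n). norm (matrix_power M k) \<le> norm (mat 1 :: real^'n^'n) * (K * norm M) ^ k"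
proof -
  obtain K where K: "K > 0" "\<And>(a :: real^'n^'n) b :: real^'n^'n. norm (a ** b) \<le> norm a * norm b * K"
    using bounded_bilinear.pos_bounded[OF bounded_bilinear_matrix_matrix_mult] by metis
  have "norm (matrix_power M k) \<le> norm (mat 1 :: real^'n^'n) * (K * norm M) ^ k" for M :: "real^'n^'n" and k
  proof (induction k)
    case (Suc k)
    have "norm (matrix_power M (Suc k)) \<le> (K * norm M) * norm (matrix_power M k)"
      using K(2)[of M "matrix_power M k"] by (simp add: matrix_power_Suc mult_ac)
    also have "\<dots> \<le> (K * norm M) * (norm (mat 1 :: real^'n^'n) * (K * norm M) ^ k)"
      using Suc K(1) by (intro mult_left_mono) auto
    finally show ?case by (simp add: mult_ac)
  qed simp
  with K(1) show ?thesis using that by blast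
qed

definition mexp :: "real^'n^'n \<Rightarrow> real^'n^'n" where
  "mexp M = suminf (\<lambda>k. (1 / fact k) *\<^sub>R matrix_power M k)"

text \<open>The Weierstrass test on balls yields both the pointwise sum and, since the partial sums
  are continuous, the continuity of \<open>mexp\<close>.\<close>

lemma uniform_limit_mexp:
  fixes r :: real
  shows "uniform_limit (cball 0 r) (\<lambda>n M. \<Sum>k<n. (1 / fact k) *\<^sub>R matrix_power (M :: real^'n^'n) k) mexp sequentially"
proof -
  obtain K where K: "K > 0" "\<And>k (M :: real^'n^'n). norm (matrix_power M k) \<le> norm (mat 1 :: real^'n^'n) * (K * norm M) ^ k"
    using norm_matrix_power_le by blast
  have "uniform_limit (cball 0 r) (\<lambda>n M. \<Sum>k<n. (1 / fact k) *\<^sub>R matrix_power (M :: real^'n^'n) k)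
          (\<lambda>M. suminf (\<lambda>k. (1 / fact k) *\<^sub>R matrix_power M k)) sequentially"
  proof (rule Weierstrass_m_test)
    fix k and M :: "real^'n^'n" assume M: "M \<in> cball 0 r"
    have "norm (matrix_power M k) \<le> norm (mat 1 :: real^'n^'n) * (K * norm M) ^ k" by (rule K)
    also have "\<dots> \<le> norm (mat 1 :: real^'n^'n) * (K * r) ^ k"
      using M K(1) by (intro mult_left_mono power_mono) auto
    finally show "norm ((1 / fact k) *\<^sub>R matrix_power M k) \<le> norm (mat 1 :: real^'n^'n) * (inverse (fact k) * (K * r) ^ k)"
      by (simp add: divide_simps)
  next
    show "summable (\<lambda>k. norm (mat 1 :: real^'n^'n) * (inverse (fact k) * (K * r) ^ k))"
      by (intro summable_mult summable_exp)
  qed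
  then show ?thesis by (simp add: mexp_def[abs_def])
qed

lemma mexp_sums: "(\<lambda>k. (1 / fact k) *\<^sub>R matrix_power M k) sums mexp M"
  unfolding sums_def
  using tendsto_uniform_limitI[OF uniform_limit_mexp, of M "norm M"] by simp

lemma continuous_on_matrix_power: "continuous_on S (\<lambda>M :: real^'n^'n. matrix_power M k)"
  by (induction k) (auto simp: matrix_power_Suc intro!: continuous_intros)

lemma continuous_on_mexp_UNIV: "continuous_on UNIV (mexp :: real^'n^'n \<Rightarrow> _)"
proof -
  have "isCont mexp M" for M :: "real^'n^'n"
  proof -
    have "continuous_on (cball 0 (norm M + 1)) (mexp :: real^'n^'n \<Rightarrow> _)"
      by (rule uniform_limit_theorem[OF _ uniform_limit_mexp])
         (auto intro!: always_eventually continuous_intros continuous_on_matrix_power)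
    then have "continuous_on (ball 0 (norm M + 1)) (mexp :: real^'n^'n \<Rightarrow> _)"
      by (rule continuous_on_subset) auto
    then show ?thesis
      by (simp add: continuous_on_eq_continuous_at)
  qed
  then show ?thesis by (simp add: continuous_on_eq_continuous_at)
qed

lemma continuous_on_mexp [continuous_intros]:
  "continuous_on S f \<Longrightarrow> continuous_on S (\<lambda>x. mexp (f x))"
  using continuous_on_compose2[OF continuous_on_mexp_UNIV] by blast

lemma mexp_0 [simp]: "mexp 0 = mat 1"
proof -
  have "matrix_power (0 :: real^'n^'n) k = 0" if "k \<noteq> 0" for k
    using that by (cases k) (auto simp: matrix_power_Suc)
  then have "mexp (0 :: real^'n^'n) = (\<Sum>k\<in>{0}. (1 / fact k) *\<^sub>R matrix_power 0 k)"
    unfolding mexp_def by (intro suminf_finite) auto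
  then show ?thesis by simp
qed

lemma mexp_commute: "M ** mexp (t *\<^sub>R M) = mexp (t *\<^sub>R M) ** M"
proof -
  have 1: "(\<lambda>k. M ** ((1 / fact k) *\<^sub>R matrix_power (t *\<^sub>R M) k)) sums (M ** mexp (t *\<^sub>R M))"
    by (intro bounded_linear.sums[OF bounded_bilinear.bounded_linear_right[OF bounded_bilinear_matrix_matrix_mult]] mexp_sums)
  have 2: "(\<lambda>k. ((1 / fact k) *\<^sub>R matrix_power (t *\<^sub>R M) k) ** M) sums (mexp (t *\<^sub>R M) ** M)"
    by (intro bounded_linear.sums[OF bounded_bilinear.bounded_linear_left[OF bounded_bilinear_matrix_matrix_mult]] mexp_sums)
  have "M ** ((1 / fact k) *\<^sub>R matrix_power (t *\<^sub>R M) k) = ((1 / fact k) *\<^sub>R matrix_power (t *\<^sub>R M) k) ** M" for k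
    using matrix_power_Suc[of M k] matrix_power_Suc2[of M k]
    by (simp add: matrix_power_scaleR scaleR_matrix_mult_left scaleR_matrix_mult_right)
  with 1 2 show ?thesis using sums_unique2 by simp
qed

text \<open>Each entry is an everywhere convergent real power series in \<open>t\<close>. Termwise
  differentiation shifts the coefficient from the power \<open>k\<close> of \<open>M\<close> over
  \<open>fact k\<close> to the power \<open>Suc k\<close> over \<open>fact k\<close>, which is the
  series of \<open>M ** mexp (t *\<^sub>R M)\<close>.\<close>

lemma has_vector_derivative_mexp:
  "((\<lambda>t. mexp (t *\<^sub>R M)) has_vector_derivative M ** mexp (t *\<^sub>R M)) (at t)"
proof -
  have entry: "(\<lambda>k. (matrix_power M k $ i $ j / fact k) * s ^ k) sums (mexp (s *\<^sub>R M) $ i $ j)" for s i j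
    using bounded_linear.sums[OF bounded_linear_vec_nth bounded_linear.sums[OF bounded_linear_vec_nth mexp_sums[of "s *\<^sub>R M"]], of i j]
    by (simp add: matrix_power_scaleR mult_ac)
  have entry': "(\<lambda>k. diffs (\<lambda>k. matrix_power M k $ i $ j / fact k) k * s ^ k) sums ((M ** mexp (s *\<^sub>R M)) $ i $ j)" for s i j
  proof -
    have "diffs (\<lambda>k. matrix_power M k $ i $ j / fact k) k * s ^ k =
       (\<Sum>l\<in>UNIV. M $ i $ l * ((matrix_power M k $ l $ j / fact k) * s ^ k))" for k
    proof -
      have "diffs (\<lambda>k. matrix_power M k $ i $ j / fact k) k = matrix_power M (Suc k) $ i $ j / fact k"
        by (simp add: diffs_def fact_Suc divide_simps del: of_nat_Suc)
      then show ?thesis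
        by (simp add: matrix_power_Suc matrix_matrix_mult_def sum_distrib_left sum_distrib_right sum_divide_distrib mult_ac)
    qed
    moreover have "(\<lambda>k. \<Sum>l\<in>UNIV. M $ i $ l * ((matrix_power M k $ l $ j / fact k) * s ^ k))
        sums (\<Sum>l\<in>UNIV. M $ i $ l * mexp (s *\<^sub>R M) $ l $ j)"
      by (intro sums_sum sums_mult entry)
    ultimately show ?thesis by (simp add: matrix_matrix_mult_def)
  qed
  have "((\<lambda>t. mexp (t *\<^sub>R M) $ i $ j) has_vector_derivative (M ** mexp (t *\<^sub>R M)) $ i $ j) (at t)" for i j
  proof -
    have "((\<lambda>s. suminf (\<lambda>k. (matrix_power M k $ i $ j / fact k) * s ^ k)) has_field_derivative
       suminf (\<lambda>k. diffs (\<lambda>k. matrix_power M k $ i $ j / fact k) k * t ^ k)) (at t)"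
      by (rule termdiffs_strong_converges_everywhere) (use entry sums_summable in blast)
    then show ?thesis
      using entry[THEN sums_unique] entry'[THEN sums_unique]
      by (simp add: has_real_derivative_iff_has_vector_derivative)
  qed
  then show ?thesis
    unfolding has_vector_derivative_def
    by (subst has_derivative_componentwise_within)
       (auto simp: Basis_vec_def inner_axis has_vector_derivative_def)
qed

text \<open>By the product rule and commutation the left side has derivative zero in
  \<open>t\<close>, so it keeps its value at \<open>0\<close>.\<close>

lemma mexp_minus_mult: "mexp (- (t *\<^sub>R M)) ** mexp (t *\<^sub>R M) = mat 1"
proof -
  have "((\<lambda>t. mexp (t *\<^sub>R (- M)) ** mexp (t *\<^sub>R M)) has_vector_derivative 0) (at s)" for s
    using bounded_bilinear.has_vector_derivative[OF bounded_bilinear_matrix_matrix_mult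
        has_vector_derivative_mexp[of "- M" s] has_vector_derivative_mexp[of M s]]
    using mexp_commute[of "-M" s]
    by (simp add: matrix_mul_assoc bounded_bilinear.minus_right[OF bounded_bilinear_matrix_matrix_mult]
      bounded_bilinear.minus_left[OF bounded_bilinear_matrix_matrix_mult])
  then obtain c where "\<And>s. mexp (s *\<^sub>R (- M)) ** mexp (s *\<^sub>R M) = c"
    using has_vector_derivative_zero_constant[of UNIV "\<lambda>s. mexp (s *\<^sub>R (- M)) ** mexp (s *\<^sub>R M)"] by auto
  from this[of t] this[of 0] show ?thesis by simp
qed

subsection \<open>Transition matrices of piecewise constant inputs\<close>

lemma mexp_vector_eq_0: "mexp (t *\<^sub>R M) *v x = 0 \<Longrightarrow> x = 0"
  using mexp_minus_mult[of t M] by (metis matrix_vector_mul_assoc matrix_vector_mul_lid matrix_vector_mult_0_right)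

text \<open>The \<open>j\<close>-th factor is constant in \<open>\<tau>\<close> outside \<open>[j h, (j + 1) h]\<close> and equals the identity to the right
  of it: the flow of the generator \<open>M j\<close> on that interval, normalized to be the identity at \<open>\<tau> = N h\<close>.
  Clamping the time makes joint continuity in \<open>(M, \<tau>)\<close> immediate.\<close>

primrec pw_flow :: "real \<Rightarrow> (nat \<Rightarrow> real^'n^'n) \<Rightarrow> nat \<Rightarrow> real \<Rightarrow> real^'n^'n" where
  "pw_flow h M 0 \<tau> = mat 1"
| "pw_flow h M (Suc j) \<tau> = pw_flow h M j \<tau> **
     mexp ((max (real j * h) (min (real (Suc j) * h) \<tau>) - real (Suc j) * h) *\<^sub>R M j)"

lemma pw_flow_eq_1:
  assumes "h \<ge> 0" "real j * h \<le> \<tau>"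
  shows "pw_flow h M j \<tau> = mat 1"
  using assms(2)
proof (induction j)
  case (Suc j)
  moreover from Suc.prems assms(1) have "real j * h \<le> real (Suc j) * h"
    by (intro mult_right_mono) auto
  ultimately show ?case by simp
qed simp

text \<open>Every factor is an exponential and hence injective. This is what later prevents a
  nonzero state from being carried to zero.\<close>

lemma pw_flow_vector_eq_0: "pw_flow h M j \<tau> *v x = 0 \<Longrightarrow> x = 0"
proof (induction j arbitrary: x)
  case (Suc j)
  then show ?case
    by (metis matrix_vector_mul_assoc mexp_vector_eq_0 pw_flow.simps(2))
qed simp

lemma continuous_on_pw_flow [continuous_intros]:
  assumes "\<And>j. j < N \<Longrightarrow> continuous_on S (\<lambda>z. M z j)" "continuous_on S \<tau>"
  shows "continuous_on S (\<lambda>z. pw_flow h (M z) N (\<tau> z))"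
  using assms(1)
  by (induction N) (auto intro!: continuous_intros assms(2))

text \<open>On the \<open>k\<close>-th open interval the factors of index below \<open>k\<close> are
  the identity, those above \<open>k\<close> are constant, and only factor \<open>k\<close> moves;
  hence \<open>M k\<close> comes out on the left of the whole product.\<close>

lemma has_vector_derivative_pw_flow:
  assumes "h \<ge> 0" "real k * h < \<tau>" "\<tau> < real (Suc k) * h" "k < j"
  shows "(pw_flow h M j has_vector_derivative M k ** pw_flow h M j \<tau>) (at \<tau>)"
  using assms(4)
proof (induction j)
  case (Suc j)
  let ?I = "{real k * h <..< real (Suc k) * h}"
  have \<tau>: "\<tau> \<in> ?I" using assms by auto
  show ?case
  proof (cases "k = j")
    case True
    have eq: "pw_flow h M (Suc j) s = mexp ((s - real (Suc k) * h) *\<^sub>R M k)" if "s \<in> ?I" for s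
      using that True assms(1) by (simp add: pw_flow_eq_1)
    have "((\<lambda>s. s - real (Suc k) * h) has_vector_derivative 1) (at \<tau>)"
      by (auto intro!: derivative_eq_intros)
    from vector_diff_chain_at[OF this has_vector_derivative_mexp]
    have "((\<lambda>s. mexp ((s - real (Suc k) * h) *\<^sub>R M k)) has_vector_derivative
        M k ** mexp ((\<tau> - real (Suc k) * h) *\<^sub>R M k)) (at \<tau>)"
      by (simp add: o_def)
    with eq[OF \<tau>] have "((\<lambda>s. mexp ((s - real (Suc k) * h) *\<^sub>R M k)) has_vector_derivative
        M k ** pw_flow h M (Suc j) \<tau>) (at \<tau>)" by simp
    then show ?thesis
      by (rule has_vector_derivative_transform_within_open[where S="?I"]) (use \<tau> eq in auto)
  next
    case False
    with Suc.prems have "k < j" by simp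
    \<comment> \<open>To the left of interval \<open>j\<close> the clamped time is stuck at
      \<open>j h\<close>, so the last factor is this constant.\<close>
    define c where "c = mexp ((real j * h - real (Suc j) * h) *\<^sub>R M j)"
    have kj: "real (Suc k) * h \<le> real j * h" "real j * h \<le> real (Suc j) * h"
      using \<open>k < j\<close> assms(1) by (intro mult_right_mono; simp)+
    have eq: "pw_flow h M (Suc j) s = pw_flow h M j s ** c" if "s \<in> ?I" for s
    proof -
      have "max (real j * h) (min (real (Suc j) * h) s) = real j * h"
        using that kj by simp
      then show ?thesis by (simp add: c_def)
    qed
    have "((\<lambda>s. pw_flow h M j s ** c) has_vector_derivative (M k ** pw_flow h M j \<tau>) ** c) (at \<tau>)"
      using bounded_bilinear.has_vector_derivative[OF bounded_bilinear_matrix_matrix_mult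
          Suc.IH[OF \<open>k < j\<close>] has_vector_derivative_const, of c]
      by simp
    with eq[OF \<tau>] have "((\<lambda>s. pw_flow h M j s ** c) has_vector_derivative (M k ** pw_flow h M (Suc j) \<tau>)) (at \<tau>)"
      by (simp add: matrix_mul_assoc)
    then show ?thesis
      by (rule has_vector_derivative_transform_within_open[where S="?I"]) (use \<tau> eq in auto)
  qed
qed simp

text \<open>The values of \<open>f\<close> at the break points are free: on each piece
  \<open>f\<close> differs from the continuous \<open>g k\<close> in at most two points.\<close>

lemma integrable_on_piecewise:
  fixes f :: "real \<Rightarrow> 'a::euclidean_space"
  assumes "\<And>k. k < N \<Longrightarrow> t k \<le> t (Suc k)"
    and "\<And>k. k < N \<Longrightarrow> continuous_on {t k..t (Suc k)} (g k)"
    and "\<And>k s. k < N \<Longrightarrow> s \<in> {t k<..<t (Suc k)} \<Longrightarrow> f s = g k s"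
  shows "f integrable_on {t 0..t N}"
proof -
  have "t 0 \<le> t N \<and> f integrable_on {t 0..t N}"
    using assms
  proof (induction N)
    case (Suc N)
    then have IH: "t 0 \<le> t N" "f integrable_on {t 0..t N}" by auto
    have "f integrable_on {t N..t (Suc N)}"
      by (rule integrable_spike_finite[where S="{t N, t (Suc N)}" and f="g N"])
         (use Suc.prems(2,3)[of N] in \<open>auto intro: integrable_continuous_interval\<close>)
    then show ?case
      using IH Suc.prems(1)[of N] Henstock_Kurzweil_Integration.integrable_combine[OF IH(1) _ IH(2)] \<open>f integrable_on {t N..t (Suc N)}\<close> by auto
  qed (use integrable_on_refl[of f "t 0"] in simp)
  then show ?thesis by blast
qed

lemma grid_interval:
  assumes "h > 0" "0 \<le> \<tau>" "\<tau> < real N * h"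
  obtains k where "k < N" "real k * h \<le> \<tau>" "\<tau> < real (Suc k) * h"
proof -
  define k where "k = nat \<lfloor>\<tau> / h\<rfloor>"
  have "0 \<le> \<tau> / h" using assms by simp
  then have k: "real k \<le> \<tau> / h" "\<tau> / h < real (Suc k)"
    unfolding k_def by linarith+
  then have 1: "real k * h \<le> \<tau>" "\<tau> < real (Suc k) * h"
    using assms(1) by (simp_all add: field_simps)
  have "real k * h < real N * h" using 1 assms(3) by linarith
  then have "k < N" using assms(1) by simp
  then show ?thesis using 1 that by blast
qed

text \<open>The flow is continuous and satisfies the equation off the finitely many nodes, which
  suffices for the fundamental theorem of calculus. Domination by a continuous function upgrades
  integrability to absolute integrability. The base point is the right end because the Gramian uses
  the transition matrix from the final time.\<close>

lemma fundamental_solution_pw_flow: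
  assumes h: "h > 0" and a: "0 \<le> a" "a \<le> real N * h"
    and u: "\<And>k s. k < N \<Longrightarrow> real k * h < s \<Longrightarrow> s < real (Suc k) * h \<Longrightarrow> A (u s) = M k"
    and B: "\<And>s. s \<in> {0..real N * h} \<Longrightarrow> norm (A (u s)) \<le> B"
  shows "fundamental_solution A u a (real N * h) (real N * h) (pw_flow h M N)"
proof -
  let ?b = "real N * h" and ?X = "pw_flow h M N"
  let ?S = "(\<lambda>k. real k * h) ` {..<N}"
  have cont: "continuous_on T ?X" for T by (intro continuous_intros)
  have FTC: "((\<lambda>\<tau>. A (u \<tau>) ** ?X \<tau>) has_integral (?X d - ?X c)) {c..d}"
    if "0 \<le> c" "c \<le> d" "d \<le> ?b" for c d
  proof (rule fundamental_theorem_of_calculus_interior_strong[of ?S])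
    fix x assume x: "x \<in> {c<..<d} - ?S"
    with that have "0 \<le> x" "x < ?b" by auto
    then obtain k where k: "k < N" "real k * h \<le> x" "x < real (Suc k) * h"
      using grid_interval[OF h] by blast
    with x have "real k * h < x" by (force simp: less_le)
    note k = k(1) this k(3)
    show "(?X has_vector_derivative A (u x) ** ?X x) (at x)"
      using has_vector_derivative_pw_flow[OF _ k(2,3,1), of M] u[OF k] h by simp
  qed (use that cont in auto)
  obtain K where K: "\<And>(a :: real^'a^'a) b :: real^'a^'a. norm (a ** b) \<le> norm a * norm b * K" "K > 0"
    using bounded_bilinear.pos_bounded[OF bounded_bilinear_matrix_matrix_mult] by metis
  have "(\<lambda>\<tau>. A (u \<tau>) ** ?X \<tau>) absolutely_integrable_on {a..?b}"
  proof (rule absolutely_integrable_integrable_bound)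
    fix x assume "x \<in> {a..?b}"
    then show "norm (A (u x) ** ?X x) \<le> B * norm (?X x) * K"
      using a K(2) B[of x] by (intro order_trans[OF K(1)] mult_right_mono) auto
  next
    show "(\<lambda>\<tau>. A (u \<tau>) ** ?X \<tau>) integrable_on {a..?b}"
      using FTC[of a ?b] a by blast
    show "(\<lambda>x. B * norm (?X x) * K) integrable_on {a..?b}"
      by (intro integrable_continuous_interval continuous_intros cont)
  qed
  moreover have "?X d - ?X c = integral {c..d} (\<lambda>\<tau>. A (u \<tau>) ** ?X \<tau>)" if "a \<le> c \<and> c \<le> d \<and> d \<le> ?b" for c d
    using FTC[of c d] that a by (simp add: integral_unique)
  ultimately show ?thesis
    using h unfolding fundamental_solution_def by (auto simp: pw_flow_eq_1)
qed

section \<open>Uniqueness of Caratheodory solutions\<close>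

text \<open>Inserting the inequality into itself \<open>k\<close> times bounds
  \<open>norm (D c)\<close> by \<open>B * (L * (b - c)) ^ k / fact k\<close>, which tends to zero.
  Time runs backward since solutions are pinned at the right end.\<close>

lemma backward_gronwall:
  fixes D :: "real \<Rightarrow> 'a::real_normed_vector"
  assumes cont: "continuous_on {a..b} D" and L: "L \<ge> 0"
    and le: "\<And>c. c \<in> {a..b} \<Longrightarrow> norm (D c) \<le> integral {c..b} (\<lambda>\<tau>. L * norm (D \<tau>))"
    and c: "c \<in> {a..b}"
  shows "D c = 0"
proof -
  obtain B where "\<forall>x\<in>D ` {a..b}. norm x \<le> B"
    using compact_imp_bounded[OF compact_continuous_image[OF cont compact_Icc]]
    unfolding bounded_iff by blast
  then have B: "norm (D s) \<le> B" if "s \<in> {a..b}" for s using that by blast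
  have main: "\<forall>c\<in>{a..b}. norm (D c) \<le> B * (L * (b - c)) ^ k / fact k" for k
  proof (induction k)
    case (Suc k)
    show ?case
    proof
      fix c assume c: "c \<in> {a..b}"
      let ?p = "\<lambda>\<tau>. L * (B * (L * (b - \<tau>)) ^ k / fact k)"
      \<comment> \<open>The sign compensates for differentiating in \<open>b - \<tau>\<close>; this
        antiderivative vanishes at \<open>b\<close>, so only its value at \<open>c\<close>
        survives.\<close>
      have "((\<lambda>\<tau>. - (B * (L * (b - \<tau>)) ^ Suc k / fact (Suc k))) has_vector_derivative ?p \<tau>) (at \<tau> within {c..b})" for \<tau>
        unfolding has_real_derivative_iff_has_vector_derivative[symmetric]
        by (auto intro!: derivative_eq_intros simp: divide_simps fact_Suc simp del: of_nat_Suc power_Suc)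
           (auto simp: algebra_simps power_Suc)
      then have int: "(?p has_integral (B * (L * (b - c)) ^ Suc k / fact (Suc k))) {c..b}"
        using fundamental_theorem_of_calculus[of c b "\<lambda>\<tau>. - (B * (L * (b - \<tau>)) ^ Suc k / fact (Suc k))" ?p] c
        by simp
      have "norm (D c) \<le> integral {c..b} (\<lambda>\<tau>. L * norm (D \<tau>))" by (rule le[OF c])
      also have "\<dots> \<le> integral {c..b} ?p"
      proof (rule integral_le)
        show "(\<lambda>\<tau>. L * norm (D \<tau>)) integrable_on {c..b}"
          using c by (intro integrable_continuous_interval continuous_intros continuous_on_subset[OF cont]) auto
        show "?p integrable_on {c..b}" using int by blast
        show "L * norm (D \<tau>) \<le> ?p \<tau>" if "\<tau> \<in> {c..b}" for \<tau>
          using Suc.IH L that c by (intro mult_left_mono) auto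
      qed
      also have "\<dots> = B * (L * (b - c)) ^ Suc k / fact (Suc k)"
        using int by (rule integral_unique)
      finally show "norm (D c) \<le> B * (L * (b - c)) ^ Suc k / fact (Suc k)" .
    qed
  qed (use B in simp)
  have "(\<lambda>k. B * (inverse (fact k) * (L * (b - c)) ^ k)) \<longlonglongrightarrow> B * 0"
    by (intro tendsto_mult_left summable_LIMSEQ_zero summable_exp)
  then have "norm (D c) \<le> B * 0"
    by (rule LIMSEQ_le_const) (use main c in \<open>auto simp: divide_simps\<close>)
  then show ?thesis by simp
qed

text \<open>The difference of two solutions is the integral of \<open>A (u \<tau>)\<close> applied
  to it, up to sign, so the Gronwall iteration forces it to vanish. Uniqueness is what gives the
  description operator in \<open>transition_matrix\<close> a meaning.\<close>

lemma fundamental_solution_unique: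
  fixes A :: "real^'p \<Rightarrow> real^'n^'n"
  assumes X: "fundamental_solution A u a b b X" and Y: "fundamental_solution A u a b b Y"
    and B: "\<And>s. s \<in> {a..b} \<Longrightarrow> norm (A (u s)) \<le> B" and c: "c \<in> {a..b}"
  shows "X c = Y c"
proof -
  let ?f = "\<lambda>X \<tau>. A (u \<tau>) ** X \<tau>"
  have int: "?f X integrable_on {a..b}" "?f Y integrable_on {a..b}"
    using X Y by (auto simp: fundamental_solution_def set_lebesgue_integral_eq_integral(1))
  obtain K where K: "\<And>(a :: real^'n^'n) b :: real^'n^'n. norm (a ** b) \<le> norm a * norm b * K" "K > 0"
    using bounded_bilinear.pos_bounded[OF bounded_bilinear_matrix_matrix_mult] by metis
  have eq: "Z s = mat 1 - integral {s..b} (?f Z)"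
    if "fundamental_solution A u a b b Z" "s \<in> {a..b}" for Z s
  proof -
    have "\<forall>c d. a \<le> c \<and> c \<le> d \<and> d \<le> b \<longrightarrow> Z d - Z c = integral {c..d} (?f Z)" "Z b = mat 1"
      using that(1) unfolding fundamental_solution_def by blast+
    moreover from this(1)[rule_format, of s b] that(2) have "Z b - Z s = integral {s..b} (?f Z)"
      by simp
    ultimately show ?thesis by (simp add: algebra_simps)
  qed
  \<comment> \<open>\<open>fundamental_solution\<close> only states an integral equation; continuity
    is that of an indefinite integral.\<close>
  have contZ: "continuous_on {a..b} Z" if "fundamental_solution A u a b b Z" for Z
  proof -
    have "?f Z integrable_on {a..b}" using that 
      by (auto simp: fundamental_solution_def set_lebesgue_integral_eq_integral(1))
    then have "continuous_on {a..b} (\<lambda>s. mat 1 - integral {s..b} (?f Z))"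
      by (intro continuous_intros indefinite_integral_continuous_1')
    then show ?thesis by (rule continuous_on_eq) (simp add: eq[OF that])
  qed
  let ?D = "\<lambda>s. X s - Y s"
  have contD: "continuous_on {a..b} ?D" by (intro continuous_intros contZ X Y)
  have "?D c = 0"
  proof (rule backward_gronwall[OF contD _ _ c])
    show "0 \<le> B * K" using B[OF c] K(2) by (smt (verit) norm_ge_zero mult_nonneg_nonneg)
    fix s assume s: "s \<in> {a..b}"
    have sub: "{s..b} \<subseteq> {a..b}" using s by auto
    have int': "?f X integrable_on {s..b}" "?f Y integrable_on {s..b}"
      using int[THEN integrable_subinterval_real, OF sub] by auto
    have diff: "?f X \<tau> - ?f Y \<tau> = A (u \<tau>) ** ?D \<tau>" for \<tau>
      by (simp add: bounded_bilinear.diff_right[OF bounded_bilinear_matrix_matrix_mult])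
    have "norm (?D s) = norm (integral {s..b} (\<lambda>\<tau>. ?f X \<tau> - ?f Y \<tau>))"
      by (simp add: eq[OF X s] eq[OF Y s] integral_diff[OF int'] norm_minus_commute)
    also have "\<dots> \<le> integral {s..b} (\<lambda>\<tau>. B * K * norm (?D \<tau>))"
    proof (rule integral_norm_bound_integral)
      show "(\<lambda>\<tau>. ?f X \<tau> - ?f Y \<tau>) integrable_on {s..b}"
        by (intro integrable_diff int')
      show "(\<lambda>\<tau>. B * K * norm (?D \<tau>)) integrable_on {s..b}"
        by (intro integrable_continuous_interval continuous_intros continuous_on_subset[OF contZ sub] X Y)
      show "norm (?f X \<tau> - ?f Y \<tau>) \<le> B * K * norm (?D \<tau>)" if "\<tau> \<in> {s..b}" for \<tau>
      proof -
        have "norm (A (u \<tau>)) * norm (?D \<tau>) * K \<le> B * norm (?D \<tau>) * K"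
          using B[of \<tau>] that sub K(2) by (intro mult_right_mono) auto
        then show ?thesis unfolding diff using K(1)[of "A (u \<tau>)" "?D \<tau>"] by (simp add: mult_ac)
      qed
    qed
    finally show "norm (?D s) \<le> integral {s..b} (\<lambda>\<tau>. B * K * norm (?D \<tau>))" .
  qed
  then show ?thesis by simp
qed

lemma transition_matrix_pw_flow:
  assumes h: "h > 0" and \<tau>: "0 \<le> \<tau>" "\<tau> \<le> real N * h"
    and u: "\<And>k s. k < N \<Longrightarrow> real k * h < s \<Longrightarrow> s < real (Suc k) * h \<Longrightarrow> A (u s) = M k"
    and B: "\<And>s. s \<in> {0..real N * h} \<Longrightarrow> norm (A (u s)) \<le> B"
  shows "transition_matrix A u \<tau> (real N * h) = pw_flow h M N \<tau>"
proof -
  let ?b = "real N * h"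
  have fs: "fundamental_solution A u \<tau> ?b ?b (pw_flow h M N)"
    by (rule fundamental_solution_pw_flow[where A=A and u=u and B=B]) (fact h \<tau> u B)+
  show ?thesis
    unfolding transition_matrix_def min_absorb2[OF \<tau>(2)] max_absorb1[OF \<tau>(2)]
  proof (rule the_equality)
    show "\<exists>X. fundamental_solution A u \<tau> ?b ?b X \<and> X \<tau> = pw_flow h M N \<tau>"
      using fs by blast
    fix Z assume "\<exists>X. fundamental_solution A u \<tau> ?b ?b X \<and> X \<tau> = Z"
    then obtain X where X: "fundamental_solution A u \<tau> ?b ?b X" "X \<tau> = Z" by blast
    show "Z = pw_flow h M N \<tau>"
      using fundamental_solution_unique[OF X(1) fs, of B \<tau>] B \<tau> X(2) by auto
  qed
qed

subsection \<open>Polynomial functions of bounded degree\<close>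

text \<open>Functions rather than formal polynomials are tracked, with an upper bound in place of
  the exact degree: such a class is closed under sums despite cancellation, and minors and
  substitutions need no formal counterpart.\<close>

definition polyfun :: "nat \<Rightarrow> (real ^ 'p::finite \<Rightarrow> real) set" where
  "polyfun d = {f. \<exists>P. rpoly_degree P \<le> d \<and> f = rpoly_eval P}"

lemma rpoly_degree_le_iff:
  "rpoly_degree P \<le> d \<longleftrightarrow> (\<forall>e\<in>Poly_Mapping.keys P. (\<Sum>i\<in>UNIV. Poly_Mapping.lookup e i) \<le> d)"
  unfolding rpoly_degree_def by auto

lemma rpoly_eval_superset:
  assumes "finite S" "Poly_Mapping.keys P \<subseteq> S"
  shows "rpoly_eval P x = (\<Sum>e\<in>S. Poly_Mapping.lookup P e * (\<Prod>i\<in>UNIV. (x $ i) ^ Poly_Mapping.lookup e i))"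
  unfolding rpoly_eval_def using assms
  by (intro sum.mono_neutral_left) (auto simp: in_keys_iff)

lemma rpoly_eval_add: "rpoly_eval (P + Q) x = rpoly_eval P x + rpoly_eval Q x"
proof -
  let ?S = "Poly_Mapping.keys P \<union> Poly_Mapping.keys Q"
  have "Poly_Mapping.keys (P + Q) \<subseteq> ?S" by (rule keys_add)
  then show ?thesis
    by (simp add: rpoly_eval_superset[of ?S] lookup_add algebra_simps sum.distrib)
qed

lemma rpoly_eval_single:
  "rpoly_eval (Poly_Mapping.single e c) x = c * (\<Prod>i\<in>UNIV. (x $ i) ^ Poly_Mapping.lookup e i)"
  by (subst rpoly_eval_superset[of "{e}"]) auto

lemma polyfun_mono: "f \<in> polyfun d \<Longrightarrow> d \<le> d' \<Longrightarrow> f \<in> polyfun d'"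
  unfolding polyfun_def using order_trans by blast

lemma polyfun_const: "(\<lambda>x. c) \<in> polyfun d"
proof -
  have "rpoly_degree (Poly_Mapping.single 0 c :: 'a rpoly) \<le> d"
    by (simp add: rpoly_degree_le_iff)
  moreover have "(\<lambda>x. c) = rpoly_eval (Poly_Mapping.single 0 c :: 'a rpoly)"
    by (simp add: rpoly_eval_single fun_eq_iff)
  ultimately show ?thesis unfolding polyfun_def by blast
qed

lemma polyfun_add: "f \<in> polyfun d \<Longrightarrow> g \<in> polyfun d \<Longrightarrow> (\<lambda>x. f x + g x) \<in> polyfun d"
proof -
  assume "f \<in> polyfun d" "g \<in> polyfun d"
  then obtain P Q where "rpoly_degree P \<le> d" "f = rpoly_eval P" "rpoly_degree Q \<le> d" "g = rpoly_eval Q"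
    unfolding polyfun_def by blast
  moreover from this have "rpoly_degree (P + Q) \<le> d"
    using keys_add[of P Q] by (auto simp: rpoly_degree_le_iff)
  ultimately show ?thesis
    unfolding polyfun_def by (auto simp: rpoly_eval_add fun_eq_iff intro!: exI[of _ "P + Q"])
qed

lemma polyfun_sum: "(\<And>i. i \<in> I \<Longrightarrow> f i \<in> polyfun d) \<Longrightarrow> (\<lambda>x. \<Sum>i\<in>I. f i x) \<in> polyfun d"
  by (induction I rule: infinite_finite_induct) (auto intro: polyfun_const polyfun_add)

text \<open>The product is expanded into one monomial for each pair of exponents, and each of these
  has degree at most \<open>d + d'\<close>.\<close>

lemma polyfun_mult:
  assumes "f \<in> polyfun d" "g \<in> polyfun d'"
  shows "(\<lambda>x. f x * g x) \<in> polyfun (d + d')"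
proof -
  obtain P Q where P: "rpoly_degree P \<le> d" "f = rpoly_eval P" and Q: "rpoly_degree Q \<le> d'" "g = rpoly_eval Q"
    using assms unfolding polyfun_def by blast
  have "(\<lambda>x. \<Sum>e\<in>Poly_Mapping.keys P. \<Sum>e'\<in>Poly_Mapping.keys Q.
      rpoly_eval (Poly_Mapping.single (e + e') (Poly_Mapping.lookup P e * Poly_Mapping.lookup Q e')) x) \<in> polyfun (d + d')"
  proof (intro polyfun_sum)
    fix e e' assume e: "e \<in> Poly_Mapping.keys P" "e' \<in> Poly_Mapping.keys Q"
    then have "(\<Sum>i\<in>UNIV. Poly_Mapping.lookup e i) + (\<Sum>i\<in>UNIV. Poly_Mapping.lookup e' i) \<le> d + d'"
      using P Q by (intro add_mono) (auto simp: rpoly_degree_le_iff)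
    then have "rpoly_degree (Poly_Mapping.single (e + e') (Poly_Mapping.lookup P e * Poly_Mapping.lookup Q e')) \<le> d + d'"
      by (auto simp: rpoly_degree_le_iff lookup_add sum.distrib split: if_splits)
    then show "rpoly_eval (Poly_Mapping.single (e + e') (Poly_Mapping.lookup P e * Poly_Mapping.lookup Q e')) \<in> polyfun (d + d')"
      unfolding polyfun_def by blast
  qed
  moreover have "f x * g x = (\<Sum>e\<in>Poly_Mapping.keys P. \<Sum>e'\<in>Poly_Mapping.keys Q.
      rpoly_eval (Poly_Mapping.single (e + e') (Poly_Mapping.lookup P e * Poly_Mapping.lookup Q e')) x)" for x
    unfolding P(2) Q(2) rpoly_eval_single
    by (simp add: rpoly_eval_def sum_product lookup_add power_add prod.distrib mult_ac)
  ultimately show ?thesis by simp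
qed

lemma polyfun_cmult: "f \<in> polyfun d \<Longrightarrow> (\<lambda>x. c * f x) \<in> polyfun d"
  using polyfun_mult[OF polyfun_const[of c 0], of f d] by simp

lemma polyfun_prod:
  "(\<And>i. i \<in> I \<Longrightarrow> f i \<in> polyfun (d i)) \<Longrightarrow> (\<lambda>x. \<Prod>i\<in>I. f i x) \<in> polyfun (\<Sum>i\<in>I. d i)"
  by (induction I rule: infinite_finite_induct) (auto intro: polyfun_const polyfun_mult)

lemma polyfun_component: "(\<lambda>x. x $ i) \<in> polyfun 1"
proof -
  let ?e = "Poly_Mapping.single i (1 :: nat)"
  have "(\<Sum>j\<in>UNIV. Poly_Mapping.lookup ?e j) = (\<Sum>j\<in>UNIV. if j = i then 1 else 0)"
    by (intro sum.cong) (simp_all add: lookup_single when_def)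
  then have "rpoly_degree (Poly_Mapping.single ?e 1) \<le> 1"
    by (simp add: rpoly_degree_le_iff)
  moreover have "(\<lambda>x. x $ i) = rpoly_eval (Poly_Mapping.single ?e 1)"
  proof
    fix x :: "real^'a"
    have "(\<Prod>j\<in>UNIV. (x $ j) ^ Poly_Mapping.lookup ?e j) = (\<Prod>j\<in>UNIV. if j = i then x $ j else 1)"
      by (intro prod.cong) (simp_all add: lookup_single when_def)
    then show "x $ i = rpoly_eval (Poly_Mapping.single ?e 1) x"
      by (simp add: rpoly_eval_single prod.delta)
  qed
  ultimately show ?thesis unfolding polyfun_def by blast
qed

lemma polyfun_linear:
  assumes "linear l"
  shows "(\<lambda>x. l x :: real) \<in> polyfun 1"
proof -
  define g where "g x = (\<Sum>i\<in>UNIV. l (axis i 1) * x $ i)" for x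
  have "l x = g x" for x
  proof -
    have "l x = l (\<Sum>i\<in>UNIV. x $ i *\<^sub>R axis i 1)"
      using basis_expansion[of x] by (simp add: scalar_mult_eq_scaleR)
    then show ?thesis by (simp add: g_def linear_sum[OF assms] linear_cmul[OF assms] mult.commute)
  qed
  moreover have "(\<lambda>x. g x) \<in> polyfun 1"
    unfolding g_def by (intro polyfun_sum polyfun_cmult polyfun_component)
  ultimately show ?thesis by simp
qed

text \<open>A monomial of degree at most \<open>d\<close> turns into a product of at most
  \<open>d\<close> factors of degree at most one.\<close>

lemma polyfun_compose_affine:
  assumes "f \<in> polyfun d" "\<And>i. (\<lambda>x. \<phi> x $ i) \<in> polyfun 1"
  shows "(\<lambda>x. f (\<phi> x)) \<in> polyfun d"
proof -
  obtain P where P: "rpoly_degree P \<le> d" "f = rpoly_eval P"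
    using assms unfolding polyfun_def by blast
  have pow: "(\<lambda>x. (\<phi> x $ i) ^ n) \<in> polyfun n" for i n
    using polyfun_prod[of "{..<n}" "\<lambda>_ x. \<phi> x $ i" "\<lambda>_. 1"] assms(2) by simp
  have "(\<lambda>x. \<Prod>i\<in>UNIV. (\<phi> x $ i) ^ Poly_Mapping.lookup e i) \<in> polyfun d"
    if "e \<in> Poly_Mapping.keys P" for e
    by (rule polyfun_mono[OF polyfun_prod[OF pow]])
       (use that P(1) in \<open>simp add: rpoly_degree_le_iff\<close>)
  then show ?thesis
    unfolding P(2) rpoly_eval_def by (intro polyfun_sum polyfun_cmult)
qed

lemma polyfun_polymap: "(\<lambda>u. polymap P u $ i $ j) \<in> polyfun (polymap_degree P)"
proof -
  have "{rpoly_degree (P $ i $ j) |i j. True} = (\<lambda>(i, j). rpoly_degree (P $ i $ j)) ` UNIV"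
    by auto
  then have "finite {rpoly_degree (P $ i $ j) |i j. True}" by simp
  then have "rpoly_degree (P $ i $ j) \<le> polymap_degree P"
    unfolding polymap_degree_def by (intro Max_ge) auto
  then show ?thesis
    unfolding polymap_def polyfun_def by (auto intro!: exI[of _ "P $ i $ j"])
qed

lemma polyfun_matrix_mult:
  assumes "\<And>i j. (\<lambda>u. M u $ i $ j) \<in> polyfun d" "\<And>i j. (\<lambda>u. M' u $ i $ j) \<in> polyfun d'"
  shows "(\<lambda>u. (M u ** M' u) $ i $ j) \<in> polyfun (d + d')"
  unfolding matrix_matrix_mult_def by simp (intro polyfun_sum polyfun_mult assms)

lemma polyfun_matrix_power:
  assumes "\<And>i j. (\<lambda>u. M u $ i $ j) \<in> polyfun d"
  shows "(\<lambda>u. matrix_power (M u) k $ i $ j) \<in> polyfun (k * d)"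
proof (induction k arbitrary: i j)
  case 0
  show ?case by (simp add: mat_def polyfun_const)
next
  case (Suc k)
  show ?case
    using polyfun_matrix_mult[OF assms Suc] by (simp add: matrix_power_Suc)
qed

text \<open>The bound \<open>d i\<close> depends on the row only: each term of the Leibniz formula
  takes one entry from every row, so the row bounds add up.\<close>

lemma polyfun_det:
  assumes "\<And>i j. (\<lambda>u. M u $ i $ j) \<in> polyfun (d i)"
  shows "(\<lambda>u. det (M u)) \<in> polyfun (\<Sum>i\<in>UNIV. d i)"
  unfolding det_def by (intro polyfun_sum polyfun_cmult polyfun_prod assms)

text \<open>A function with a nonzero value cannot come from the zero polynomial, so general
  position applies to any polynomial representing it.\<close>

lemma general_position_polyfun:
  assumes "general_position d E" "f \<in> polyfun d" "f x \<noteq> 0"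
  shows "\<exists>v\<in>E. f v \<noteq> 0"
proof -
  obtain P where P: "rpoly_degree P \<le> d" "f = rpoly_eval P"
    using assms unfolding polyfun_def by blast
  then have "P \<noteq> 0" using assms(3) by (auto simp: rpoly_eval_def)
  then show ?thesis using assms(1) P unfolding general_position_def by blast
qed

lemma continuous_on_polymap [continuous_intros]:
  "continuous_on S f \<Longrightarrow> continuous_on S (\<lambda>x. polymap P (f x))"
proof -
  assume f: "continuous_on S f"
  have "continuous_on S (\<lambda>x. rpoly_eval (P $ i $ j) (f x))" for i j
    unfolding rpoly_eval_def by (intro continuous_intros f)
  then show ?thesis unfolding polymap_def by (intro continuous_intros)
qed

subsection \<open>Observability\<close>

text \<open>The row space of the first \<open>k\<close> blocks of the observability matrix.\<close>

definition krylov_span :: "real^'n^'m \<Rightarrow> real^'n^'n \<Rightarrow> nat \<Rightarrow> (real^'n) set" where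
  "krylov_span C A k = span {row i (C ** matrix_power A j) | i j. j < k}"

text \<open>Passing from one block to the next thus becomes the action of one linear map,
  \<open>transpose A\<close>, on rows.\<close>

lemma row_matrix_mult: "row i (A ** B) = transpose B *v row i A" for A :: "real^'k^'m" and B :: "real^'n^'k"
  by (simp add: row_def matrix_matrix_mult_def vector_matrix_mult_def vec_eq_iff mult.commute)

lemma krylov_span_mono: "j \<le> k \<Longrightarrow> krylov_span C A j \<subseteq> krylov_span C A k"
  unfolding krylov_span_def by (rule span_mono) (blast intro: less_le_trans)

lemma subspace_krylov_span: "subspace (krylov_span C A k)"
  unfolding krylov_span_def by (rule subspace_span)

lemma row_in_krylov_span: "j < k \<Longrightarrow> row i (C ** matrix_power A j) \<in> krylov_span C A k"
  unfolding krylov_span_def by (auto intro!: span_base)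

text \<open>If the rows of block \<open>l\<close> lie in the span of the earlier blocks, applying
  \<open>transpose A\<close> puts the rows of block \<open>Suc l\<close> in the span of blocks
  \<open>1\<close> to \<open>l\<close>. So a chain that stops growing once never grows
  again.\<close>

lemma krylov_span_stable:
  assumes "krylov_span C A (Suc k) \<subseteq> krylov_span C A k"
  shows "krylov_span C A j \<subseteq> krylov_span C A k"
proof -
  have step: "krylov_span C A (Suc (Suc l)) \<subseteq> krylov_span C A (Suc l)"
    if *: "krylov_span C A (Suc l) \<subseteq> krylov_span C A l" for l
    unfolding krylov_span_def[of _ _ "Suc (Suc l)"]
  proof (rule span_minimal[OF _ subspace_krylov_span], clarify)
    fix i j assume j: "j < Suc (Suc l)"
    show "row i (C ** matrix_power A j) \<in> krylov_span C A (Suc l)"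
    proof (cases "j < Suc l")
      case True
      then show ?thesis by (rule row_in_krylov_span)
    next
      case False
      with j have [simp]: "j = Suc l" by simp
      have "row i (C ** matrix_power A l) \<in> krylov_span C A (Suc l)"
        by (simp add: row_in_krylov_span)
      then have "row i (C ** matrix_power A l) \<in> krylov_span C A l" using * by auto
      then have "transpose A *v row i (C ** matrix_power A l) \<in> (*v) (transpose A) ` krylov_span C A l"
        by blast
      also have "(*v) (transpose A) ` krylov_span C A l
          = span ((*v) (transpose A) ` {row i (C ** matrix_power A j) | i j. j < l})"
        unfolding krylov_span_def by (rule linear_span_image[symmetric]) simp
      also have "\<dots> \<subseteq> krylov_span C A (Suc l)"
        unfolding krylov_span_def
        by (rule span_mono)
           (force simp del: transpose_matrix_vector simp: row_matrix_mult[symmetric] matrix_mul_assoc[symmetric] matrix_power_Suc2[symmetric])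
      finally show ?thesis
        by (simp del: transpose_matrix_vector add: row_matrix_mult[symmetric] matrix_mul_assoc[symmetric] matrix_power_Suc2)
    qed
  qed
  have "krylov_span C A (Suc (k + m)) \<subseteq> krylov_span C A (k + m)" for m
    by (induction m) (use assms step in auto)
  then have "krylov_span C A (k + m) \<subseteq> krylov_span C A k" for m
    by (induction m) (auto dest: subset_trans)
  then show ?thesis
    using krylov_span_mono[of j "k + j" C A] by auto
qed

text \<open>Each step either raises the dimension or stops the chain for good, and it can only stop
  at the full space.\<close>

lemma dim_krylov_span_ge:
  fixes A :: "real^'n^'n"
  assumes "krylov_span C A n = UNIV"
  shows "k \<le> CARD('n) \<Longrightarrow> k \<le> dim (krylov_span C A k)"
proof (induction k)
  case (Suc k)
  have sub: "krylov_span C A k \<subseteq> krylov_span C A (Suc k)" by (rule krylov_span_mono) simp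
  show ?case
  proof (cases "krylov_span C A (Suc k) \<subseteq> krylov_span C A k")
    case True
    from krylov_span_stable[OF this, of n] assms have "krylov_span C A k = UNIV" by auto
    with sub have "krylov_span C A (Suc k) = UNIV" by auto
    then show ?thesis using Suc.prems by (simp add: dim_UNIV)
  next
    case False
    have span: "span (krylov_span C A j) = krylov_span C A j" for j
      unfolding krylov_span_def by (rule span_span)
    have "dim (krylov_span C A k) < dim (krylov_span C A (Suc k))"
      by (rule dim_psubset) (use sub False in \<open>auto simp: span\<close>)
    then show ?thesis using Suc by auto
  qed
qed simp

text \<open>Full column rank means trivial kernel, and \<open>to_nat_on\<close> runs through all
  block indices below \<open>CARD('n)\<close>. The kernel form is what the minor and the output
  argument work with.\<close>

lemma observable_iff_kernel:
  fixes C :: "real^'n^'m"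
  shows "observable C A \<longleftrightarrow> (\<forall>x. (\<forall>j<CARD('n). C *v (matrix_power A j *v x) = 0) \<longrightarrow> x = 0)"
proof -
  let ?O = "observability_matrix C A"
  have bij: "bij_betw (to_nat_on (UNIV :: 'n set)) UNIV {..<CARD('n)}"
    by (rule to_nat_on_finite) simp
  have row: "(?O *v x) $ (a, i) = (C *v (matrix_power A (to_nat_on (UNIV :: 'n set) a) *v x)) $ i" for x a i
    unfolding observability_matrix_def matrix_vector_mul_assoc
    by (simp add: matrix_vector_mult_def row_def)
  have "?O *v x = 0 \<longleftrightarrow> (\<forall>j<CARD('n). C *v (matrix_power A j *v x) = 0)" for x
  proof -
    have "?O *v x = 0 \<longleftrightarrow> (\<forall>a. C *v (matrix_power A (to_nat_on (UNIV :: 'n set) a) *v x) = 0)"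
      by (simp add: vec_eq_iff row)
    also have "\<dots> \<longleftrightarrow> (\<forall>j\<in>to_nat_on (UNIV :: 'n set) ` UNIV. C *v (matrix_power A j *v x) = 0)"
      by auto
    also have "to_nat_on (UNIV :: 'n set) ` UNIV = {..<CARD('n)}"
      using bij by (rule bij_betw_imp_surj_on)
    finally show ?thesis by auto
  qed
  moreover have "observable C A \<longleftrightarrow> (\<forall>x. ?O *v x = 0 \<longrightarrow> x = 0)"
    unfolding observable_def full_rank_injective
    by (simp add: linear_injective_0)
  ultimately show ?thesis by simp
qed

text \<open>Otherwise a nonzero vector orthogonal to all rows of all blocks would lie in the kernel
  of the observability matrix.\<close>

lemma observable_krylov_span:
  fixes C :: "real^'n^'m"
  assumes "observable C A"
  shows "krylov_span C A CARD('n) = UNIV"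
proof (rule ccontr)
  assume ne: "krylov_span C A CARD('n) \<noteq> UNIV"
  have "dim (krylov_span C A CARD('n)) < DIM(real^'n)"
    using dim_eq_full[of "krylov_span C A CARD('n)"] dim_subset_UNIV[of "krylov_span C A CARD('n)"] ne
    by (simp add: krylov_span_def span_span)
  then obtain x where x: "x \<noteq> 0" "\<And>y. y \<in> span (krylov_span C A CARD('n)) \<Longrightarrow> orthogonal x y"
    using orthogonal_to_subspace_exists[of "krylov_span C A CARD('n)"] by blast
  have "(C ** matrix_power A j) *v x = 0" if "j < CARD('n)" for j
  proof -
    have "((C ** matrix_power A j) *v x) $ i = 0" for i
    proof -
      have "row i (C ** matrix_power A j) \<in> span (krylov_span C A CARD('n))"
        unfolding krylov_span_def span_span using that by (auto intro!: span_base)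
      from x(2)[OF this] show ?thesis
        by (simp add: matrix_vector_mul_component orthogonal_def inner_commute row_def vec_nth_inverse)
    qed
    then show ?thesis by (simp add: vec_eq_iff)
  qed
  then have "\<forall>j<CARD('n). C *v (matrix_power A j *v x) = 0" by (simp add: matrix_vector_mul_assoc)
  with assms x(1) show False unfolding observable_iff_kernel by blast
qed

text \<open>Greedy choice: since the Krylov spaces grow strictly until they fill everything, the \<open>k\<close>-th row
  can be taken from a block of index at most \<open>k\<close>, whence the bound \<open>n (n - 1) / 2\<close> in the degree.\<close>

lemma observable_independent_rows:
  fixes C :: "real^'n^'m"
  assumes "observable C A"
  shows "k \<le> CARD('n) \<Longrightarrow> \<exists>i l. (\<forall>j<k. l j \<le> j) \<and>
    k \<le> dim ((\<lambda>j. row (i j) (C ** matrix_power A (l j))) ` {..<k})"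
proof (induction k)
  case (Suc k)
  then obtain i l where il: "\<forall>j<k. l j \<le> j" "k \<le> dim ((\<lambda>j. row (i j) (C ** matrix_power A (l j))) ` {..<k})"
    by auto
  let ?B = "(\<lambda>j. row (i j) (C ** matrix_power A (l j))) ` {..<k}"
  have "dim ?B \<le> card ?B" by (rule dim_le_card[OF span_superset]) simp
  also have "\<dots> \<le> k" using card_image_le[of "{..<k}"] by simp
  finally have dimB: "dim ?B \<le> k" .
  \<comment> \<open>The \<open>k\<close> rows chosen so far span at most dimension \<open>k\<close>,
    too little for the next Krylov space, so some row of a block of index at most \<open>k\<close>
    is new.\<close>
  have "\<not> krylov_span C A (Suc k) \<subseteq> span ?B"
  proof
    assume "krylov_span C A (Suc k) \<subseteq> span ?B"
    from dim_subset[OF this] have "dim (krylov_span C A (Suc k)) \<le> k" using dimB by simp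
    with dim_krylov_span_ge[OF observable_krylov_span[OF assms] Suc.prems] show False by simp
  qed
  then have "\<not> {row i (C ** matrix_power A j) | i j. j < Suc k} \<subseteq> span ?B"
    unfolding krylov_span_def using span_minimal[OF _ subspace_span] by blast
  then obtain i' l' where l': "l' < Suc k" and new: "row i' (C ** matrix_power A l') \<notin> span ?B" by blast
  let ?i = "i(k := i')" and ?l = "l(k := l')"
  have "(\<lambda>j. row (?i j) (C ** matrix_power A (?l j))) ` {..<Suc k} = insert (row i' (C ** matrix_power A l')) ?B"
    by (auto simp: lessThan_Suc)
  then have "Suc k \<le> dim ((\<lambda>j. row (?i j) (C ** matrix_power A (?l j))) ` {..<Suc k})"
    using il(2) new by (simp add: dim_insert)
  moreover have "\<forall>j<Suc k. ?l j \<le> j" using il(1) l' by (auto simp: less_Suc_eq)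
  ultimately show ?case by blast
qed auto

text \<open>The rows are selected once, at input \<open>0\<close>, and the same selection serves
  every \<open>u\<close>. They are rows of the observability matrix, so a vector killed by all
  blocks is killed by \<open>H u\<close>, hence is zero wherever the minor does not vanish.\<close>

lemma observability_minor:
  fixes A :: "'p::finite rpoly ^ 'n ^ 'n" and C :: "'p rpoly ^ 'n ^ 'm"
  assumes "observable (polymap C 0) (polymap A 0)"
  obtains f where "f \<in> polyfun (CARD('n) * polymap_degree C + (CARD('n) * (CARD('n) - 1) div 2) * polymap_degree A)"
    "f 0 \<noteq> 0" "\<And>u. f u \<noteq> 0 \<Longrightarrow> observable (polymap C u) (polymap A u)"
proof -
  obtain i l where l: "\<forall>j<CARD('n). l j \<le> j"
    and dim: "CARD('n) \<le> dim ((\<lambda>j. row (i j) (polymap C 0 ** matrix_power (polymap A 0) (l j))) ` {..<CARD('n)})"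
    using observable_independent_rows[OF assms order_refl] by blast
  define \<sigma> where "\<sigma> = to_nat_on (UNIV :: 'n set)"
  have bij: "bij_betw \<sigma> UNIV {..<CARD('n)}"
    unfolding \<sigma>_def by (rule to_nat_on_finite) simp
  then have \<sigma>: "\<sigma> ` UNIV = {..<CARD('n)}" by (rule bij_betw_imp_surj_on)
  define H where "H u = (\<chi> a. row (i (\<sigma> a)) (polymap C u ** matrix_power (polymap A u) (l (\<sigma> a))))" for u
  have "rows (H 0) = (\<lambda>j. row (i j) (polymap C 0 ** matrix_power (polymap A 0) (l j))) ` {..<CARD('n)}"
    unfolding \<sigma>[symmetric] by (auto simp: rows_def H_def row_def)
  with dim have "CARD('n) \<le> rank (H 0)" by (simp add: row_rank_def)
  then have "rank (H 0) = CARD('n)" using rank_bound[of "H 0"] by simp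
  then have "det (H 0) \<noteq> 0"
    using det_nz_iff_inj[of "(*v) (H 0)"] full_rank_injective[of "H 0"] by simp
  moreover have "(\<lambda>u. det (H u)) \<in> polyfun (\<Sum>a\<in>UNIV. polymap_degree C + l (\<sigma> a) * polymap_degree A)"
  proof (rule polyfun_det)
    fix a b
    show "(\<lambda>u. H u $ a $ b) \<in> polyfun (polymap_degree C + l (\<sigma> a) * polymap_degree A)"
      using polyfun_matrix_mult[OF polyfun_polymap[of C] polyfun_matrix_power[OF polyfun_polymap[of A]]]
      by (simp add: H_def row_def)
  qed
  moreover have "(\<Sum>a\<in>(UNIV :: 'n set). polymap_degree C + l (\<sigma> a) * polymap_degree A)
     \<le> CARD('n) * polymap_degree C + (CARD('n) * (CARD('n) - 1) div 2) * polymap_degree A"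
  \<comment> \<open>Since \<open>l j\<close> is at most \<open>j\<close>, the block indices sum to
    at most 0 + 1 + ... + (n - 1).\<close>
  proof -
    have "(\<Sum>a\<in>(UNIV :: 'n set). l (\<sigma> a)) \<le> (\<Sum>a\<in>(UNIV :: 'n set). \<sigma> a)"
      using l \<sigma> by (intro sum_mono) auto
    also have "\<dots> = (\<Sum>j<CARD('n). j)"
      by (rule sum.reindex_bij_betw[OF bij])
    also have "\<dots> = CARD('n) * (CARD('n) - 1) div 2"
      using Sum_Ico_nat[of 0 "CARD('n)"] by (simp add: atLeast0LessThan)
    finally show ?thesis
      by (simp add: sum.distrib sum_distrib_right[symmetric])
  qed
  moreover have "observable (polymap C u) (polymap A u)" if "det (H u) \<noteq> 0" for u
    unfolding observable_iff_kernel
  proof (intro allI impI)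
    fix x assume x: "\<forall>j<CARD('n). polymap C u *v (matrix_power (polymap A u) j *v x) = 0"
    have "H u *v x = 0"
    proof -
      have "(H u *v x) $ a = (polymap C u *v (matrix_power (polymap A u) (l (\<sigma> a)) *v x)) $ i (\<sigma> a)" for a
        unfolding matrix_vector_mul_assoc by (simp add: H_def row_def matrix_vector_mult_def)
      moreover have "l (\<sigma> a) < CARD('n)" for a
      proof -
        have "\<sigma> a < CARD('n)" using \<sigma> by blast
        then show ?thesis using l by (meson le_less_trans)
      qed
      ultimately show ?thesis using x by (simp add: vec_eq_iff)
    qed
    moreover have "inj ((*v) (H u))"
      using that det_nz_iff_inj[of "(*v) (H u)"] by simp
    ultimately show "x = 0" by (simp add: linear_injective_0)
  qed
  ultimately show ?thesis using that polyfun_mono by blast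
qed

subsection \<open>Gramians of piecewise constant inputs\<close>

text \<open>The rows are unit vectors, which bounds the set; orthogonality is an equation between
  continuous maps, which closes it.\<close>

lemma compact_orthogonal_matrices: "compact {R :: real^'n^'n. orthogonal_matrix R}"
  unfolding compact_eq_bounded_closed
proof
  have "norm R \<le> real CARD('n)" if "orthogonal_matrix R" for R :: "real^'n^'n"
  proof -
    have "norm (R $ i) = 1" for i
      using that unfolding orthogonal_matrix_orthonormal_rows by (simp add: row_def vec_nth_inverse)
    then show ?thesis
      using L2_set_le_sum[of UNIV "\<lambda>i. norm (R $ i)"] by (simp add: norm_vec_def[of R])
  qed
  then show "bounded {R :: real^'n^'n. orthogonal_matrix R}"
    unfolding bounded_iff by blast
  show "closed {R :: real^'n^'n. orthogonal_matrix R}"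
    unfolding orthogonal_matrix by (intro closed_Collect_eq continuous_intros)
qed

text \<open>\<open>W\<close> maps a final state to the output at time \<open>s\<close>. The
  assumption \<open>ran\<close> restricts the values at the nodes too, which yields the pointwise
  bound on \<open>A (u s)\<close> over the closed interval that uniqueness requires.\<close>

lemma gramian_pw_flow:
  fixes A :: "real^'p \<Rightarrow> real^'n^'n" and C :: "real^'p \<Rightarrow> real^'n^'m"
  assumes h: "h > 0"
    and u: "\<And>k s. k < N \<Longrightarrow> real k * h < s \<Longrightarrow> s < real (Suc k) * h \<Longrightarrow> u s = c k"
    and ran: "\<And>s. s \<in> {0..real N * h} \<Longrightarrow> u s \<in> c ` {..<N}"
  defines "W \<equiv> \<lambda>s. C (u s) ** pw_flow h (\<lambda>k. A (c k)) N s"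
  shows "(\<lambda>s. transpose (W s) ** W s) integrable_on {0..real N * h}"
    and "gramian A C u (real N * h) 0 = integral {0..real N * h} (\<lambda>s. transpose (W s) ** W s)"
proof -
  let ?W = "\<lambda>k s. C (c k) ** pw_flow h (\<lambda>k. A (c k)) N s"
  have "(\<lambda>s. transpose (W s) ** W s) integrable_on {real 0 * h..real N * h}"
  proof (rule integrable_on_piecewise[where g="\<lambda>k s. transpose (?W k s) ** ?W k s"])
    show "real k * h \<le> real (Suc k) * h" for k
      using h by (intro mult_right_mono) auto
    show "continuous_on {real k * h..real (Suc k) * h} (\<lambda>s. transpose (?W k s) ** ?W k s)" for k
      by (intro continuous_intros)
    show "transpose (W s) ** W s = transpose (?W k s) ** ?W k s"
      if "k < N" "s \<in> {real k * h<..<real (Suc k) * h}" for k s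
      using that u[of k s] by (simp add: W_def)
  qed
  then show "(\<lambda>s. transpose (W s) ** W s) integrable_on {0..real N * h}" by simp
  have B: "norm (A (u s)) \<le> (\<Sum>k<N. norm (A (c k)))" if s: "s \<in> {0..real N * h}" for s
  proof -
    obtain k where "k < N" "u s = c k" using ran[OF s] by auto
    then show ?thesis using member_le_sum[of k "{..<N}" "\<lambda>k. norm (A (c k))"] by simp
  qed
  have "transition_matrix A u s (real N * h) = pw_flow h (\<lambda>k. A (c k)) N s"
    if "s \<in> {0..real N * h}" for s
    using that by (intro transition_matrix_pw_flow[where B="\<Sum>k<N. norm (A (c k))"] h B) (auto simp: u)
  then show "gramian A C u (real N * h) 0 = integral {0..real N * h} (\<lambda>s. transpose (W s) ** W s)"
    unfolding gramian_def by (intro integral_cong) (simp add: W_def matrix_transpose_mul matrix_mul_assoc)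
qed

lemma bounded_linear_quadratic_form: "bounded_linear (\<lambda>M :: real^'n^'n. x \<bullet> (M *v x))"
  by (intro bounded_linear_compose[OF bounded_linear_inner_right]
      bounded_bilinear.bounded_linear_left[OF bounded_bilinear_matrix_vector_mult])

lemma quadratic_form_integral:
  fixes W :: "real \<Rightarrow> real^'n^'m"
  assumes "(\<lambda>s. transpose (W s) ** W s) integrable_on S"
  shows "(\<lambda>s. (norm (W s *v x))\<^sup>2) integrable_on S"
    and "x \<bullet> (integral S (\<lambda>s. transpose (W s) ** W s) *v x) = integral S (\<lambda>s. (norm (W s *v x))\<^sup>2)"
proof -
  have eq: "x \<bullet> ((transpose (W s) ** W s) *v x) = (norm (W s *v x))\<^sup>2" for s
    by (simp add: matrix_vector_mul_assoc[symmetric] dot_lmul_matrix power2_norm_eq_inner inner_commute[of x])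
  show "(\<lambda>s. (norm (W s *v x))\<^sup>2) integrable_on S"
    using integrable_linear[OF assms bounded_linear_quadratic_form[of x]] by (simp add: o_def eq)
  show "x \<bullet> (integral S (\<lambda>s. transpose (W s) ** W s) *v x) = integral S (\<lambda>s. (norm (W s *v x))\<^sup>2)"
    using integral_linear[OF assms bounded_linear_quadratic_form[of x]] by (simp add: o_def eq)
qed

lemma transpose_integral_gram:
  fixes W :: "real \<Rightarrow> real^'n^'m"
  assumes "(\<lambda>s. transpose (W s) ** W s) integrable_on S"
  shows "transpose (integral S (\<lambda>s. transpose (W s) ** W s)) = integral S (\<lambda>s. transpose (W s) ** W s)"
  using integral_linear[OF assms bounded_linear_transpose]
  by (simp add: o_def matrix_transpose_mul)

section \<open>Positive output energy on an observable subinterval\<close>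

text \<open>Differentiating an output that vanishes on an open interval brings down one factor
  \<open>A\<close> at a time. Hence \<open>C ** matrix_power A j\<close> kills the state for every
  \<open>j\<close>, and observability makes the state zero.\<close>

lemma observable_output_eq_0:
  fixes C :: "real^'n^'m"
  assumes obs: "observable C A"
    and X: "\<And>s. s \<in> {a<..<b} \<Longrightarrow> (X has_vector_derivative A ** X s) (at s)"
    and zero: "\<And>s. s \<in> {a<..<b} \<Longrightarrow> C *v (X s *v x) = 0"
    and s: "s \<in> {a<..<b}"
  shows "X s *v x = 0"
proof -
  have "\<forall>s\<in>{a<..<b}. C *v (matrix_power A j *v (X s *v x)) = 0" for j
  proof (induction j)
    case (Suc j)
    show ?case
    proof
      fix s assume s: "s \<in> {a<..<b}"
      let ?g = "\<lambda>M. C *v (matrix_power A j *v (M *v x))"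
      have "bounded_linear ?g"
        by (intro bounded_linear_compose[OF matrix_vector_mul_bounded_linear]
            bounded_bilinear.bounded_linear_left[OF bounded_bilinear_matrix_vector_mult])
      from bounded_linear.has_vector_derivative[OF this X[OF s]]
      have "((\<lambda>s. ?g (X s)) has_vector_derivative ?g (A ** X s)) (at s)" .
      moreover have "((\<lambda>s. ?g (X s)) has_vector_derivative 0) (at s)"
        by (rule has_vector_derivative_transform_within_open[OF has_vector_derivative_const, of "{a<..<b}"])
           (use s Suc.IH in auto)
      ultimately have "?g (A ** X s) = 0" by (rule vector_derivative_unique_at)
      then show "C *v (matrix_power A (Suc j) *v (X s *v x)) = 0"
        by (simp add: matrix_power_Suc2 matrix_vector_mul_assoc matrix_mul_assoc)
    qed
  qed (use zero in simp)
  with obs s show ?thesis unfolding observable_iff_kernel by blast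
qed

text \<open>A continuous nonnegative integrand with integral zero vanishes throughout. The state
  would then be zero at the midpoint, against the injectivity of the flow.\<close>

lemma integral_pw_flow_output_pos:
  fixes C :: "real^'n^'m"
  assumes "observable C (M k)" "h > 0" "k < N" "x \<noteq> 0"
  shows "integral {real k * h..real (Suc k) * h} (\<lambda>s. (norm (C *v (pw_flow h M N s *v x)))\<^sup>2) > 0"
proof -
  let ?q = "\<lambda>s. (norm (C *v (pw_flow h M N s *v x)))\<^sup>2"
  let ?a = "real k * h" and ?b = "real (Suc k) * h"
  have ab: "?a < ?b" using assms(2) by simp
  have cont: "continuous_on {?a..?b} ?q" by (intro continuous_intros)
  have int: "?q integrable_on {?a..?b}" by (rule integrable_continuous_interval[OF cont])
  have "integral {?a..?b} ?q \<noteq> 0"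
  proof
    assume "integral {?a..?b} ?q = 0"
    with int have "(?q has_integral 0) (cbox ?a ?b)" by (metis box_real(2) integrable_integral)
    then have "?q s = 0" if "s \<in> cbox ?a ?b" for s
      using has_integral_0_cbox_imp_0[of ?a ?b ?q s] cont ab that by (simp add: box_real)
    then have zero: "C *v (pw_flow h M N s *v x) = 0" if "s \<in> {?a<..<?b}" for s
      using that by (simp add: cbox_interval)
    have "pw_flow h M N ((?a + ?b) / 2) *v x = 0"
      by (rule observable_output_eq_0[OF assms(1) has_vector_derivative_pw_flow zero])
         (use assms ab in auto)
    then show False using pw_flow_vector_eq_0 assms(4) by blast
  qed
  moreover have "integral {?a..?b} ?q \<ge> 0" by (intro integral_nonneg int) auto
  ultimately show ?thesis by linarith
qed

section \<open>Uniform lower bound by compactness\<close>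

lemma control_template_piecewise_constant:
  fixes A :: "real^'p \<Rightarrow> real^'n^'n" and C :: "real^'p \<Rightarrow> real^'n^'m"
  assumes contA: "continuous_on UNIV A" and contC: "continuous_on UNIV C" and h: "h > 0"
    and v: "\<And>k s. k < N \<Longrightarrow> real k * h < s \<Longrightarrow> s < real (Suc k) * h \<Longrightarrow> v s = c k"
    and ran: "\<And>s. s \<in> {0..real N * h} \<Longrightarrow> v s \<in> c ` {..<N}"
    and obs: "\<And>\<mu> R. orthogonal_matrix R \<Longrightarrow>
      \<exists>k<N. observable (C (\<mu> *\<^sub>R (R *v c k))) (A (\<mu> *\<^sub>R (R *v c k)))"
  shows "control_template A C (real N * h) v"
  unfolding control_template_def
proof (intro conjI allI impI)
  have grid: "real k * h \<le> real (Suc k) * h" for k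
    using h by (intro mult_right_mono) auto
  have "v integrable_on {real 0 * h..real N * h}"
    by (rule integrable_on_piecewise[where g="\<lambda>k s. c k" and t="\<lambda>k. real k * h"])
       (use v grid in auto)
  then have "v \<in> borel_measurable (lebesgue_on {0..real N * h})"
    by (intro integrable_imp_measurable) simp
  moreover have "norm (v s) \<le> (\<Sum>k<N. norm (c k))" if s: "s \<in> {0..real N * h}" for s
  proof -
    obtain k where "k < N" "v s = c k" using ran[OF s] by auto
    then show ?thesis using member_le_sum[of k "{..<N}" "\<lambda>k. norm (c k)"] by simp
  qed
  ultimately show "L_infinity 0 (real N * h) v"
    unfolding L_infinity_def by (auto intro!: exI[of _ "\<Sum>k<N. norm (c k)"] AE_I2)
next
  fix L :: real assume L: "L \<ge> 0"
  define u where "u \<mu> R k = \<mu> *\<^sub>R (R *v c k)" for \<mu> :: real and R :: "real^'p^'p" and k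
  define \<Phi> where "\<Phi> \<mu> R = pw_flow h (\<lambda>k. A (u \<mu> R k)) N" for \<mu> R
  \<comment> \<open>The value \<open>c k\<close> is frozen here for all times, so \<open>q k\<close>
    is jointly continuous in parameters and time, whereas the true input may jump at the
    nodes.\<close>
  define q where "q k z s = (case z of (\<mu>, R, x) \<Rightarrow> (norm (C (u \<mu> R k) *v (\<Phi> \<mu> R s *v x)))\<^sup>2)"
    for k and z :: "real \<times> (real^'p^'p) \<times> (real^'n)" and s
  define I where "I k = {real k * h..real (Suc k) * h}" for k
  define J where "J z = (\<Sum>k<N. integral (I k) (q k z))" for z
  let ?K = "{0..L} \<times> {R :: real^'p^'p. orthogonal_matrix R} \<times> sphere (0 :: real^'n) 1"
  have contq: "continuous_on UNIV (\<lambda>(z, s). q k z s)" for k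
    unfolding q_def \<Phi>_def u_def case_prod_beta
    by (intro continuous_intros continuous_on_compose2[OF contA] continuous_on_compose2[OF contC]) auto
  have intq: "q k z integrable_on I k" for k z
  proof -
    have "continuous_on (I k) (\<lambda>s. (\<lambda>(z, s). q k z s) (z, s))"
      by (rule continuous_on_compose2[OF contq]) (auto intro!: continuous_intros)
    then show ?thesis unfolding I_def by (intro integrable_continuous_interval) simp
  qed
  have q_nonneg: "0 \<le> q k z s" for k z s by (simp add: q_def split: prod.split)
  have "continuous_on ?K J"
    unfolding J_def I_def cbox_interval[symmetric]
    by (intro continuous_intros integral_continuous_on_param continuous_on_subset[OF contq]) auto
  moreover have "compact ?K"
    by (intro compact_Times compact_Icc compact_orthogonal_matrices compact_sphere)
  moreover have Jpos: "J z > 0" if zK: "z \<in> ?K" for z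
  proof -
    obtain \<mu> R x where z: "z = (\<mu>, R, x)" by (cases z)
    then obtain k where k: "k < N" "observable (C (u \<mu> R k)) (A (u \<mu> R k))"
      using zK obs[of R \<mu>] unfolding u_def by auto
    have "x \<noteq> 0" using zK z by auto
    then have "integral (I k) (q k z) > 0"
      using integral_pw_flow_output_pos[of _ "\<lambda>k. A (u \<mu> R k)", OF k(2) h k(1)] z
      by (simp add: I_def q_def[abs_def] \<Phi>_def)
    also have "integral (I k) (q k z) \<le> J z"
      unfolding J_def using k(1)
      by (intro member_le_sum integral_nonneg intq q_nonneg) auto
    finally show ?thesis .
  qed
  \<comment> \<open>\<open>m\<close> is the attained minimum of \<open>J\<close>; the case of an
    empty \<open>?K\<close> is settled by the value 1.\<close>
  ultimately obtain m where m: "m > 0" "\<And>z. z \<in> ?K \<Longrightarrow> m \<le> J z"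
  proof (cases "?K = {}")
    case False
    assume *: "continuous_on ?K J" "compact ?K"
    from continuous_attains_inf[OF *(2) False *(1)] obtain z where "z \<in> ?K" "\<forall>y\<in>?K. J z \<le> J y" by blast
    with Jpos that show ?thesis by blast
  qed (use zero_less_one that in blast)
  \<comment> \<open>The value of \<open>v\<close> at \<open>0\<close> lies in the image of
    \<open>{..<N}\<close>, which is therefore nonempty.\<close>
  have N: "N > 0" using ran[of 0] h by (cases N) auto
  show "\<exists>g>0. \<forall>\<mu> R. 0 \<le> \<mu> \<and> \<mu> \<le> L \<and> orthogonal_matrix R \<longrightarrow>
        positive_semidefinite (gramian A C (\<lambda>s. \<mu> *\<^sub>R (R *v v s)) (real N * h) 0 - g *\<^sub>R mat 1)"
  proof (intro exI conjI allI impI)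
    \<comment> \<open>Each of the \<open>N\<close> energies in \<open>J\<close> is at most the total
      energy, so \<open>J\<close> is at most \<open>N\<close> times the quadratic form of the
      Gramian. This crude bound avoids splitting the integral.\<close>
    show "m / N > 0" using m(1) N by simp
    fix \<mu> R assume \<mu>R: "0 \<le> \<mu> \<and> \<mu> \<le> L \<and> orthogonal_matrix (R :: real^'p^'p)"
    define W where "W s = C (\<mu> *\<^sub>R (R *v v s)) ** \<Phi> \<mu> R s" for s
    let ?G = "gramian A C (\<lambda>s. \<mu> *\<^sub>R (R *v v s)) (real N * h) 0"
    let ?I = "{0..real N * h}"
    have uk: "\<mu> *\<^sub>R (R *v v s) = u \<mu> R k" if "k < N" "real k * h < s" "s < real (Suc k) * h" for k s
      using v[OF that] by (simp add: u_def)
    have ur: "\<mu> *\<^sub>R (R *v v s) \<in> u \<mu> R ` {..<N}" if "s \<in> ?I" for s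
      using ran[OF that] by (auto simp: u_def)
    have W: "(\<lambda>s. transpose (W s) ** W s) integrable_on ?I"
      and G: "?G = integral ?I (\<lambda>s. transpose (W s) ** W s)"
      using gramian_pw_flow[where N=N and u="\<lambda>s. \<mu> *\<^sub>R (R *v v s)" and c="u \<mu> R" and C=C and A=A, OF h uk ur]
      unfolding W_def \<Phi>_def by blast+
    have unit: "m / N \<le> y \<bullet> (?G *v y)" if "norm y = 1" for y
    proof -
      have "(\<mu>, R, y) \<in> ?K" using \<mu>R that by simp
      then have "m \<le> J (\<mu>, R, y)" by (rule m(2))
      also have "\<dots> \<le> (\<Sum>k<N. y \<bullet> (?G *v y))"
        unfolding J_def
      proof (intro sum_mono)
        fix k assume k: "k \<in> {..<N}"
        let ?p = "\<lambda>s. (norm (W s *v y))\<^sup>2"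
        have sub: "I k \<subseteq> ?I"
          unfolding I_def using k h by (auto intro: order_trans[OF _ mult_right_mono])
        have p: "?p integrable_on ?I" by (rule quadratic_form_integral[OF W])
        have "integral (I k) (q k (\<mu>, R, y)) = integral (I k) ?p"
        proof (rule integral_spike[of "{real k * h, real (Suc k) * h}"])
          show "?p s = q k (\<mu>, R, y) s" if "s \<in> I k - {real k * h, real (Suc k) * h}" for s
          proof -
            have "v s = c k" using that k v[of k s] unfolding I_def by auto
            then show ?thesis by (simp add: q_def W_def u_def matrix_vector_mul_assoc)
          qed
        qed simp
        also have "\<dots> \<le> integral ?I ?p"
          using integrable_on_subinterval[OF p] sub
          by (intro integral_subset_le p) (auto simp: I_def)
        also have "\<dots> = y \<bullet> (?G *v y)"
          unfolding G by (rule quadratic_form_integral(2)[OF W, symmetric])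
        finally show "integral (I k) (q k (\<mu>, R, y)) \<le> y \<bullet> (?G *v y)" .
      qed
      finally show ?thesis using N by (simp add: field_simps)
    qed
    \<comment> \<open>Both sides are homogeneous of degree two, so the unit sphere decides.\<close>
    have "m / N * (x \<bullet> x) \<le> x \<bullet> (?G *v x)" for x
    proof (cases "x = 0")
      case False
      define y where "y = (1 / norm x) *\<^sub>R x"
      have y: "norm y = 1" "x = norm x *\<^sub>R y" using False by (simp_all add: y_def)
      have "x \<bullet> (?G *v x) = (norm x)\<^sup>2 * (y \<bullet> (?G *v y))"
        by (subst (1 2) y(2)) (simp add: matrix_vector_mult_scaleR power2_eq_square)
      moreover have "(norm x)\<^sup>2 * (m / N) \<le> (norm x)\<^sup>2 * (y \<bullet> (?G *v y))"
        by (intro mult_left_mono unit y) simp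
      ultimately show ?thesis by (simp add: power2_norm_eq_inner mult.commute)
    qed simp
    moreover have "transpose ?G = ?G" unfolding G by (rule transpose_integral_gram[OF W])
    ultimately show "positive_semidefinite (?G - (m / N) *\<^sub>R mat 1)"
      unfolding positive_semidefinite_def
      by (simp add: linear_diff[OF bounded_linear.linear[OF bounded_linear_transpose]] transpose_scalar
          matrix_vector_mult_diff_rdistrib inner_diff_right scaleR_matrix_vector_assoc[symmetric])
  qed
qed

section \<open>The family of scaled templates\<close>

theorem theorem4p4:
  fixes A :: "'p::finite rpoly ^ 'n ^ 'n"
    and C :: "'p rpoly ^ 'n ^ 'm"
    and b :: "real ^ 'p \<Rightarrow> real ^ 'n"
    and \<iota> :: 'p
    and w :: "nat \<Rightarrow> real ^ 'p"
    and v :: "real \<Rightarrow> real \<Rightarrow> real ^ 'p"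
    and d N :: nat
    and T :: real
  assumes "continuous_on UNIV b"
    and "observable (polymap C 0) (polymap A 0)"
    and "d = CARD('n) * polymap_degree C
             + (CARD('n) * (CARD('n) - 1) div 2) * polymap_degree A"
    and "N \<ge> (CARD('p) + d) choose CARD('p)"
    and "general_position d (w ` {..<N})"
    and "w 0 = axis \<iota> 1"
    and "\<And>\<Delta> k s. \<lbrakk>\<Delta> > 0; k < N; s \<in> {real k * \<Delta> / real N ..< real (k + 1) * \<Delta> / real N}\<rbrakk>
           \<Longrightarrow> v \<Delta> s = w 0 + \<Delta> *\<^sub>R (w k - w 0)"
    and "\<And>\<Delta>. \<Delta> > 0 \<Longrightarrow> v \<Delta> \<Delta> = w 0 + \<Delta> *\<^sub>R (w (N - 1) - w 0)"
    and "T > 0"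
  shows "control_template_family \<iota> (polymap A) (polymap C) T v"
proof -
  note obs0 = assms(2) and d = assms(3) and gp = assms(5) and w0 = assms(6) and v = assms(7,8)
  have "(CARD('p) + d) choose CARD('p) > 0" by simp
  with assms(4) have N: "N > 0" by linarith
  define c where "c \<Delta> k = w 0 + \<Delta> *\<^sub>R (w k - w 0)" for \<Delta> k
  obtain f where f: "f \<in> polyfun d" "f 0 \<noteq> 0"
    and f_obs: "\<And>u. f u \<noteq> 0 \<Longrightarrow> observable (polymap C u) (polymap A u)"
    using observability_minor[OF obs0] unfolding d by blast
  have obs: "\<exists>k<N. observable (polymap C (\<mu> *\<^sub>R (R *v c \<Delta> k))) (polymap A (\<mu> *\<^sub>R (R *v c \<Delta> k)))"
    if "\<Delta> > 0" for \<mu> R \<Delta>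
  proof -
    define \<phi> where "\<phi> x = \<mu> *\<^sub>R (R *v (w 0 + \<Delta> *\<^sub>R (x - w 0)))" for x
    have "(\<lambda>x. f (\<phi> x)) \<in> polyfun d"
    proof (rule polyfun_compose_affine[OF f(1)])
      fix i
      have "linear (\<lambda>x. (\<mu> *\<^sub>R (R *v (\<Delta> *\<^sub>R x))) $ i)"
        by (auto intro!: linearI simp: matrix_vector_right_distrib matrix_vector_mult_scaleR algebra_simps)
      from polyfun_add[OF polyfun_const[of "(\<mu> *\<^sub>R (R *v (w 0 - \<Delta> *\<^sub>R w 0))) $ i"] polyfun_linear[OF this]]
      show "(\<lambda>x. \<phi> x $ i) \<in> polyfun 1"
        by (simp add: \<phi>_def matrix_vector_right_distrib matrix_vector_mult_diff_distrib algebra_simps)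
    qed
    \<comment> \<open>This point is chosen so that \<open>w 0 + \<Delta> *\<^sub>R (x - w 0)\<close>
      is zero. Hence \<open>\<phi>\<close> takes the value \<open>0\<close> whatever
      \<open>\<mu>\<close> and \<open>R\<close> are, and \<open>f\<close> does not vanish
      there.\<close>
    moreover have "f (\<phi> (w 0 - (1 / \<Delta>) *\<^sub>R w 0)) \<noteq> 0"
      using f(2) that by (simp add: \<phi>_def)
    ultimately obtain y where "y \<in> w ` {..<N}" "f (\<phi> y) \<noteq> 0"
      using general_position_polyfun[OF gp] by blast
    then show ?thesis using f_obs by (auto simp: \<phi>_def c_def)
  qed
  \<comment> \<open>The sum dominates every deviation \<open>norm (w k - w 0)\<close>; the added 1
    keeps the slope positive even if all of them vanish.\<close>
  define \<kappa> where "\<kappa> \<Delta> = (1 + (\<Sum>k<N. norm (w k - w 0))) * \<Delta>" for \<Delta>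
  have pos: "1 + (\<Sum>k<N. norm (w k - w 0)) > 0"
    by (intro add_pos_nonneg sum_nonneg) auto
  have "class_K \<kappa>"
    unfolding class_K_def \<kappa>_def
    using pos by (auto intro!: continuous_intros strict_mono_onI)
  moreover have "L_infinity 0 \<Delta> (v \<Delta>) \<and> continuous (at 0 within {0..\<Delta>}) (v \<Delta>) \<and> v \<Delta> 0 = axis \<iota> 1 \<and>
      (\<forall>s\<in>{0..\<Delta>}. norm (v \<Delta> s - v \<Delta> 0) \<le> \<kappa> \<Delta>) \<and> control_template (polymap A) (polymap C) \<Delta> (v \<Delta>)"
    if \<Delta>: "0 < \<Delta> \<and> \<Delta> \<le> T" for \<Delta>
  proof -
    define h where "h = \<Delta> / N"
    have h: "h > 0" "real N * h = \<Delta>" using \<Delta> N by (simp_all add: h_def)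
    have vk: "v \<Delta> s = c \<Delta> k" if "k < N" "real k * h \<le> s" "s < real (Suc k) * h" for k s
      using v(1)[of \<Delta> k s] \<Delta> that by (simp add: c_def h_def)
    have ran: "v \<Delta> s \<in> c \<Delta> ` {..<N}" if "s \<in> {0..real N * h}" for s
    proof (cases "s = \<Delta>")
      \<comment> \<open>The right endpoint belongs to no half-open subinterval; \<open>v\<close>
        repeats the value of index \<open>N - 1\<close> there.\<close>
      case True
      then show ?thesis using v(2)[of \<Delta>] \<Delta> N by (auto simp: c_def)
    next
      case False
      with that h have "0 \<le> s" "s < real N * h" by auto
      with grid_interval[OF h(1)] obtain k where "k < N" "real k * h \<le> s" "s < real (Suc k) * h"
        by blast
      then show ?thesis using vk by blast
    qed
    have v0: "v \<Delta> s = w 0" if "0 \<le> s" "s < h" for s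
      using vk[of 0 s] that N by (simp add: c_def)
    \<comment> \<open>The input is constantly \<open>w 0\<close> on the first subinterval, that is,
      within distance \<open>h\<close> of \<open>0\<close>.\<close>
    have "continuous (at 0 within {0..\<Delta>}) (v \<Delta>)"
      by (rule continuous_transform_within[OF continuous_const h(1), of _ _ "w 0"])
         (use \<Delta> v0 in \<open>auto simp: dist_real_def\<close>)
    moreover have "norm (v \<Delta> s - v \<Delta> 0) \<le> \<kappa> \<Delta>" if "s \<in> {0..\<Delta>}" for s
    proof -
      from that h(2) have "v \<Delta> s \<in> c \<Delta> ` {..<N}" by (intro ran) simp
      then obtain k where k: "k < N" "v \<Delta> s = c \<Delta> k" by blast
      then have "norm (v \<Delta> s - v \<Delta> 0) = norm (w k - w 0) * \<Delta>"
        using v0[of 0] h \<Delta> by (simp add: c_def)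
      also have "\<dots> \<le> \<kappa> \<Delta>"
        unfolding \<kappa>_def using member_le_sum[of k "{..<N}" "\<lambda>k. norm (w k - w 0)"] k(1) \<Delta>
        by (intro mult_right_mono) auto
      finally show ?thesis .
    qed
    moreover have "control_template (polymap A) (polymap C) (real N * h) (v \<Delta>)"
      by (rule control_template_piecewise_constant[where c="c \<Delta>"])
         (use vk ran obs h \<Delta> in \<open>auto intro!: continuous_intros\<close>)
    ultimately show ?thesis
      using v0[of 0] h w0 unfolding control_template_def by simp
  qed
  ultimately show ?thesis unfolding control_template_family_def by blast
qed

end
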